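(* Let $\mathbf A=(\theta,w,x)$ be a Q-system in $\mathcal C\subset\mathrm{End}_0(N)$ defining the extension $\iota:N\to M$ with conjugate $\bar\iota:M\to N$. Let $P\in\mathrm{Hom}(\theta,\theta)$ be a (nonzero) projection satisfying $$(1_\theta\times P)x=xP=(P\times1_\theta)x$$ (hence also $(P\times P)x=(P\times1_\theta)xP=(1_\theta\times P)xP$). Let $S\in N$ be an isometry with $SS^*=P$. Then, with normalization intertwiner $n_P=\sqrt{\dim(\theta)}\cdot1_{\theta_P}$, the formulas $$\theta_P=S^*\theta(\cdot)S,\quad w_P=\dim(\theta_P)^{-1/4}\,n_P^{1/2}S^*w,\quad x_P=\dim(\theta_P)^{1/4}\,(n_P^{-1/2}S^*\times n_P^{-1/2}S^* )\,x\,S\,n_P^{1/2}$$ define a Q-system $\mathbf A_P=(\theta_P,w_P,x_P)$ (the reduced Q-system). It corresponds to the extension $eN\subset eM$ (i.e. $n\mapsto e\iota(n)$, $N\to eM$), where $e\in M'\cap M$ is the projection with $\bar\iota(e)=P$. Along with $P$, also $1-P$ satisfies the relations $(1_\theta\times (1-P))x=x(1-P)=((1-P)\times1_\theta)x$.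
   Context: $N$ is an infinite (type III) von Neumann factor on a separable Hilbert space. Homomorphisms of von Neumann algebras are unital $*$-homomorphisms. For homomorphisms $\alpha,\beta:N\to M$, $\mathrm{Hom}(\alpha,\beta)=\{t\in M:t\alpha(n)=\beta(n)t\ \forall n\in N\}$. For $t_i\in\mathrm{Hom}(\alpha_i,\beta_i)$ put $t_1\times t_2=t_1\alpha_1(t_2)\in\mathrm{Hom}(\alpha_1\alpha_2,\beta_1\beta_2)$; thus $1_\alpha\times t=\alpha(t)$, $t\times1_\alpha=t$. $\alpha:N\to M$, $\bar\alpha:M\to N$ are conjugate if there are $w\in\mathrm{Hom}(\mathrm{id}_N,\bar\alpha\alpha)$, $\bar w\in\mathrm{Hom}(\mathrm{id}_M,\alpha\bar\alpha)$ with $w^*\bar\alpha(\bar w)=1$, $\alpha(w^* )\bar w=1$; $\dim\alpha$ is the infimum of $d$ over such pairs with $w^*w=d1_N$, $\bar w^*\bar w=d1_M$. $\mathrm{End}_0(N)$ is the C* tensor category of endomorphisms of finite dimension; $\mathcal C\subset\mathrm{End}_0(N)$ is a full tensor subcategory closed under direct sums, subobjects and conjugates. A Q-system is a triple $\mathbf A=(\theta,w,x)$ with $\theta\in\mathcal C$, $w\in\mathrm{Hom}(\mathrm{id},\theta)$, $x\in\mathrm{Hom}(\theta,\theta^2)$ satisfying $(w^*\times1_\theta)x=(1_\theta\times w^* )x=1_\theta$; $(x\times1_\theta)x=(1_\theta\times x)x$; $(1_\theta\times x^* )(x\times1_\theta)=xx^*=(x^*\times1_\theta)(1_\theta\times x)$;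 $w^*w=d_{\mathbf A}1$, $x^*x=d_{\mathbf A}1_\theta$, $d_{\mathbf A}=\sqrt{\dim\theta}$. Its extension $\iota:N\to M$ is the von Neumann algebra $M=\iota(N)v$ (each element uniquely $\iota(n)v$) with $v\iota(n)=\iota(\theta(n))v$, $v^2=\iota(x)v$, $v^*=\iota(w^*x^* )v$, $1_M=\iota(w^* )v$; the conjugate homomorphism is $\bar\iota(\iota(n)v)=\theta(n)x$, so $\theta=\bar\iota\iota$ and $x=\bar\iota(v)$. $M$ need not be a factor. Q-systems are identified up to unitary equivalence ($u\in\mathrm{Hom}(\theta,\theta')$ unitary, $w'=uw$, $x'=(u\times u)xu^*$). For a projection $P$ as in the claim, $n_P$ denotes $S^*x^*(P\times P)xS\in\mathrm{Hom}(\theta_P,\theta_P)$. *)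

theory Defs
  imports "HOL-Analysis.Analysis"
begin

section \<open>Complex Hilbert spaces and their bounded operators\<close>

text \<open>The scalar product is linear in the second argument. The norm and the topology come from
  the underlying real Hilbert space, whose scalar product is the real part.\<close>

class complex_hilbert = real_inner + complete_space +
  fixes scaleC :: "complex \<Rightarrow> 'a \<Rightarrow> 'a"  (infixr \<open>*\<^sub>C\<close> 75)
    and cinner :: "'a \<Rightarrow> 'a \<Rightarrow> complex"
  assumes scaleC_add_right: "a *\<^sub>C (x + y) = a *\<^sub>C x + a *\<^sub>C y"
    and scaleC_add_left: "(a + b) *\<^sub>C x = a *\<^sub>C x + b *\<^sub>C x"
    and scaleC_scaleC: "a *\<^sub>C (b *\<^sub>C x) = (a * b) *\<^sub>C x"
    and scaleR_scaleC: "r *\<^sub>R x = complex_of_real r *\<^sub>C x"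
    and cinner_commute: "cinner x y = cnj (cinner y x)"
    and cinner_add_right: "cinner x (y + z) = cinner x y + cinner x z"
    and cinner_scaleC_right: "cinner x (a *\<^sub>C y) = a * cinner x y"
    and inner_eq_Re_cinner: "inner x y = Re (cinner x y)"

typedef (overloaded) 'h bop =
  "{T :: 'h::complex_hilbert \<Rightarrow> 'h. bounded_linear T \<and> (\<forall>c x. T (c *\<^sub>C x) = c *\<^sub>C T x)}"
  morphisms app Abs_bop
  by (rule exI[of _ "\<lambda>x. x"]) (auto simp: bounded_linear_ident)

setup_lifting type_definition_bop

lemma scaleC_minus_right: "c *\<^sub>C (- x) = - (c *\<^sub>C (x :: 'h::complex_hilbert))"
proof -
  have "c *\<^sub>C (x + (- x)) = c *\<^sub>C x + c *\<^sub>C (- x)" by (rule scaleC_add_right)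
  moreover have "c *\<^sub>C (0 :: 'h) = 0"
    using scaleC_add_right[of c "0 :: 'h" 0] by simp
  ultimately show ?thesis by (simp add: add_eq_0_iff)
qed

lemma bounded_linear_scaleC: "bounded_linear (\<lambda>x :: 'h::complex_hilbert. c *\<^sub>C x)"
proof (rule bounded_linear_intro)
  fix x y :: 'h and r :: real
  show "c *\<^sub>C (x + y) = c *\<^sub>C x + c *\<^sub>C y" by (rule scaleC_add_right)
  show "c *\<^sub>C (r *\<^sub>R x) = r *\<^sub>R (c *\<^sub>C x)"
    by (simp add: scaleR_scaleC scaleC_scaleC mult.commute)
  have "Im (cinner x x) = 0"
    using cinner_commute[of x x] by (simp add: complex_eq_iff)
  hence "cinner x x = complex_of_real (inner x x)"
    by (simp add: complex_eq_iff inner_eq_Re_cinner)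
  hence "cinner (c *\<^sub>C x) (c *\<^sub>C x) = (c * cnj c) * complex_of_real (inner x x)"
    by (simp add: cinner_scaleC_right cinner_commute[of "c *\<^sub>C x" x])
  hence "inner (c *\<^sub>C x) (c *\<^sub>C x) = (cmod c)\<^sup>2 * inner x x"
    by (simp add: inner_eq_Re_cinner[of "c *\<^sub>C x"] complex_norm_square[symmetric]
        del: of_real_power of_real_mult flip: of_real_power of_real_mult)
  hence "(norm (c *\<^sub>C x))\<^sup>2 = (norm x * cmod c)\<^sup>2"
    by (simp add: power2_norm_eq_inner power_mult_distrib)
  thus "norm (c *\<^sub>C x) \<le> norm x * cmod c"
    by (simp add: power2_eq_iff_nonneg)
qed

instantiation bop :: (complex_hilbert) "{ring, monoid_mult}"
begin

lift_definition zero_bop :: "'a bop" is "\<lambda>x. 0"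
  using scaleC_minus_right[of _ "0 :: 'a"] scaleC_add_right[of _ "0 :: 'a" 0]
  by (auto simp: bounded_linear_zero)
lift_definition one_bop :: "'a bop" is "\<lambda>x. x" by (simp add: bounded_linear_ident)
lift_definition plus_bop :: "'a bop \<Rightarrow> 'a bop \<Rightarrow> 'a bop" is "\<lambda>S T x. S x + T x"
  by (auto simp: bounded_linear_add scaleC_add_right)
lift_definition uminus_bop :: "'a bop \<Rightarrow> 'a bop" is "\<lambda>T x. - T x"
  by (auto simp: bounded_linear_minus scaleC_minus_right)
lift_definition minus_bop :: "'a bop \<Rightarrow> 'a bop \<Rightarrow> 'a bop" is "\<lambda>S T x. S x - T x"
  by (auto simp: bounded_linear_sub scaleC_add_right[of _ _ "- _", simplified scaleC_minus_right, simplified])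
lift_definition times_bop :: "'a bop \<Rightarrow> 'a bop \<Rightarrow> 'a bop" is "\<lambda>S T x. S (T x)"
  by (auto simp: bounded_linear_compose)

instance
  by standard (transfer; force simp: linear_simps(1) dest: bounded_linear.linear linear_add)+

end

lift_definition scale_bop :: "complex \<Rightarrow> 'h::complex_hilbert bop \<Rightarrow> 'h bop"  (infixr \<open>*\<^sub>B\<close> 75)
  is "\<lambda>c T x. c *\<^sub>C T x"
  by (auto simp: scaleC_scaleC mult.commute
      intro: bounded_linear_compose[OF bounded_linear_scaleC])

definition adj :: "'h::complex_hilbert bop \<Rightarrow> 'h bop"  (\<open>_\<^sup>\<dagger>\<close> [1000] 999) where
  "T\<^sup>\<dagger> = (THE R. \<forall>x y. cinner (app T x) y = cinner x (app R y))"

definition projection :: "'h::complex_hilbert bop \<Rightarrow> bool" where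
  "projection p \<longleftrightarrow> p\<^sup>\<dagger> = p \<and> p * p = p"

definition isometry :: "'h::complex_hilbert bop \<Rightarrow> bool" where
  "isometry s \<longleftrightarrow> s\<^sup>\<dagger> * s = 1"

definition positive :: "'h::complex_hilbert bop \<Rightarrow> bool" where
  "positive T \<longleftrightarrow> (\<forall>x. Im (cinner x (app T x)) = 0 \<and> 0 \<le> Re (cinner x (app T x)))"

definition sqrt_bop :: "'h::complex_hilbert bop \<Rightarrow> 'h bop" where
  "sqrt_bop T = (THE R. positive R \<and> R * R = T)"

definition inverse_bop :: "'h::complex_hilbert bop \<Rightarrow> 'h bop" where
  "inverse_bop T = (THE R. R * T = 1 \<and> T * R = 1)"


section \<open>Von Neumann algebras, factors and homomorphisms\<close>

text \<open>For a projection \<open>u\<close> on \<open>H\<close>, the algebra \<open>B(uH)\<close> is identified with \<open>u B(H) u\<close>. This allows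
  an algebra such as \<open>eM\<close>, which acts on \<open>eH\<close> and has the unit \<open>e\<close>, to be a von Neumann algebra
  without changing the Hilbert space type. For \<open>u = 1\<close> these are the usual notions.\<close>

definition commutant_on :: "'h::complex_hilbert bop \<Rightarrow> 'h bop set \<Rightarrow> 'h bop set" where
  "commutant_on u A = {T. u * T * u = T \<and> (\<forall>a\<in>A. T * a = a * T)}"

abbreviation commutant :: "'h::complex_hilbert bop set \<Rightarrow> 'h bop set" where
  "commutant A \<equiv> commutant_on 1 A"

definition von_neumann_algebra_on :: "'h::complex_hilbert bop \<Rightarrow> 'h bop set \<Rightarrow> bool" where
  "von_neumann_algebra_on u A \<longleftrightarrow>
     projection u \<and> (\<forall>a\<in>A. u * a * u = a) \<and> (\<forall>a\<in>A. a\<^sup>\<dagger> \<in> A) \<and>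
     commutant_on u (commutant_on u A) = A"

abbreviation von_neumann_algebra :: "'h::complex_hilbert bop set \<Rightarrow> bool" where
  "von_neumann_algebra A \<equiv> von_neumann_algebra_on 1 A"

definition factor :: "'h::complex_hilbert bop set \<Rightarrow> bool" where
  "factor N \<longleftrightarrow> von_neumann_algebra N \<and> (1 :: 'h bop) \<noteq> 0 \<and>
     N \<inter> commutant N = {c *\<^sub>B 1 | c. True}"

definition mvn_equivalent :: "'h::complex_hilbert bop set \<Rightarrow> 'h bop \<Rightarrow> 'h bop \<Rightarrow> bool" where
  "mvn_equivalent N p q \<longleftrightarrow> (\<exists>t\<in>N. t\<^sup>\<dagger> * t = p \<and> t * t\<^sup>\<dagger> = q)"

definition finite_projection :: "'h::complex_hilbert bop set \<Rightarrow> 'h bop \<Rightarrow> bool" where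
  "finite_projection N p \<longleftrightarrow>
     (\<forall>q\<in>N. projection q \<and> p * q = q \<and> mvn_equivalent N p q \<longrightarrow> q = p)"

definition type_III_factor :: "'h::complex_hilbert bop set \<Rightarrow> bool" where
  "type_III_factor N \<longleftrightarrow> factor N \<and>
     (\<forall>p\<in>N. projection p \<and> p \<noteq> 0 \<longrightarrow> \<not> finite_projection N p)"

text \<open>Homomorphisms are considered as functions on the carrier only; their values elsewhere are
  irrelevant. The domain \<open>N\<close> has unit \<open>1\<close>, the target \<open>M\<close> has unit \<open>u\<close>.\<close>

definition vn_hom_on :: "'h::complex_hilbert bop set \<Rightarrow> 'k::complex_hilbert bop \<Rightarrow> 'k bop set
    \<Rightarrow> ('h bop \<Rightarrow> 'k bop) \<Rightarrow> bool" where
  "vn_hom_on N u M \<alpha> \<longleftrightarrow>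
     (\<forall>n\<in>N. \<alpha> n \<in> M) \<and> \<alpha> 1 = u \<and>
     (\<forall>m\<in>N. \<forall>n\<in>N. \<alpha> (m + n) = \<alpha> m + \<alpha> n) \<and>
     (\<forall>m\<in>N. \<forall>n\<in>N. \<alpha> (m * n) = \<alpha> m * \<alpha> n) \<and>
     (\<forall>c. \<forall>n\<in>N. \<alpha> (c *\<^sub>B n) = c *\<^sub>B \<alpha> n) \<and>
     (\<forall>n\<in>N. \<alpha> (n\<^sup>\<dagger>) = (\<alpha> n)\<^sup>\<dagger>)"

abbreviation vn_hom :: "'h::complex_hilbert bop set \<Rightarrow> 'k::complex_hilbert bop set
    \<Rightarrow> ('h bop \<Rightarrow> 'k bop) \<Rightarrow> bool" where
  "vn_hom N M \<alpha> \<equiv> vn_hom_on N 1 M \<alpha>"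


section \<open>Intertwiners, conjugates and dimension\<close>

definition Hom :: "'h::complex_hilbert bop set \<Rightarrow> 'k::complex_hilbert bop set
    \<Rightarrow> ('h bop \<Rightarrow> 'k bop) \<Rightarrow> ('h bop \<Rightarrow> 'k bop) \<Rightarrow> 'k bop set" where
  "Hom N M \<alpha> \<beta> = {t\<in>M. \<forall>n\<in>N. t * \<alpha> n = \<beta> n * t}"

text \<open>The product \<open>s \<times> t\<close> of intertwiners depends on the source \<open>\<alpha>\<close> of the first factor \<open>s\<close>,
  which is therefore displayed as an index.\<close>

definition hprod :: "'k::complex_hilbert bop \<Rightarrow> ('h::complex_hilbert bop \<Rightarrow> 'k bop) \<Rightarrow> 'h bop \<Rightarrow> 'k bop"
    (\<open>_ \<otimes>\<^bsub>_\<^esub> _\<close> [76, 0, 76] 75) where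
  "s \<otimes>\<^bsub>\<alpha>\<^esub> t = s * \<alpha> t"

definition conjugate_pair :: "'h::complex_hilbert bop set \<Rightarrow> 'k::complex_hilbert bop set
    \<Rightarrow> ('h bop \<Rightarrow> 'k bop) \<Rightarrow> ('k bop \<Rightarrow> 'h bop) \<Rightarrow> 'h bop \<Rightarrow> 'k bop \<Rightarrow> bool" where
  "conjugate_pair N M \<alpha> \<alpha>' w w' \<longleftrightarrow>
     w \<in> Hom N N id (\<alpha>' \<circ> \<alpha>) \<and> w' \<in> Hom M M id (\<alpha> \<circ> \<alpha>') \<and>
     w\<^sup>\<dagger> * \<alpha>' w' = 1 \<and> \<alpha> (w\<^sup>\<dagger>) * w' = 1"

definition conjugate :: "'h::complex_hilbert bop set \<Rightarrow> 'k::complex_hilbert bop set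
    \<Rightarrow> ('h bop \<Rightarrow> 'k bop) \<Rightarrow> ('k bop \<Rightarrow> 'h bop) \<Rightarrow> bool" where
  "conjugate N M \<alpha> \<alpha>' \<longleftrightarrow> vn_hom N M \<alpha> \<and> vn_hom M N \<alpha>' \<and> (\<exists>w w'. conjugate_pair N M \<alpha> \<alpha>' w w')"

definition dim_values :: "'h::complex_hilbert bop set \<Rightarrow> 'k::complex_hilbert bop set
    \<Rightarrow> ('h bop \<Rightarrow> 'k bop) \<Rightarrow> real set" where
  "dim_values N M \<alpha> = {d. \<exists>\<alpha>' w w'. vn_hom M N \<alpha>' \<and> conjugate_pair N M \<alpha> \<alpha>' w w' \<and>
     w\<^sup>\<dagger> * w = complex_of_real d *\<^sub>B 1 \<and> w'\<^sup>\<dagger> * w' = complex_of_real d *\<^sub>B 1}"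

text \<open>Meaningful only if the set of values is nonempty, that is, if the dimension is finite.\<close>

definition hom_dim :: "'h::complex_hilbert bop set \<Rightarrow> 'k::complex_hilbert bop set
    \<Rightarrow> ('h bop \<Rightarrow> 'k bop) \<Rightarrow> real" where
  "hom_dim N M \<alpha> = Inf (dim_values N M \<alpha>)"

definition End0 :: "'h::complex_hilbert bop set \<Rightarrow> ('h bop \<Rightarrow> 'h bop) set" where
  "End0 N = {\<alpha>. vn_hom N N \<alpha> \<and> dim_values N N \<alpha> \<noteq> {}}"

text \<open>A full subcategory is given by its objects. Closure under subobjects includes closure under
  unitary equivalence, and in particular independence of the values of \<open>\<alpha>\<close> outside \<open>N\<close>.\<close>

definition full_tensor_subcategory ::
    "'h::complex_hilbert bop set \<Rightarrow> ('h bop \<Rightarrow> 'h bop) set \<Rightarrow> bool" where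
  "full_tensor_subcategory N C \<longleftrightarrow>
     C \<subseteq> End0 N \<and> id \<in> C \<and> (\<forall>\<alpha>\<in>C. \<forall>\<beta>\<in>C. \<alpha> \<circ> \<beta> \<in> C) \<and>
     (\<forall>\<alpha>\<in>C. \<forall>\<beta>\<in>C. \<forall>\<sigma>\<in>End0 N. \<forall>s\<in>Hom N N \<alpha> \<sigma>. \<forall>t\<in>Hom N N \<beta> \<sigma>.
        isometry s \<and> isometry t \<and> s * s\<^sup>\<dagger> + t * t\<^sup>\<dagger> = 1 \<longrightarrow> \<sigma> \<in> C) \<and>
     (\<forall>\<alpha>\<in>C. \<forall>\<sigma>\<in>End0 N. \<forall>s\<in>Hom N N \<sigma> \<alpha>. isometry s \<longrightarrow> \<sigma> \<in> C) \<and>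
     (\<forall>\<alpha>\<in>C. \<forall>\<beta>\<in>End0 N. conjugate N N \<alpha> \<beta> \<longrightarrow> \<beta> \<in> C)"


section \<open>Q-systems and their extensions\<close>

definition Q_system :: "'h::complex_hilbert bop set \<Rightarrow> ('h bop \<Rightarrow> 'h bop) set
    \<Rightarrow> ('h bop \<Rightarrow> 'h bop) \<Rightarrow> 'h bop \<Rightarrow> 'h bop \<Rightarrow> bool" where
  "Q_system N C \<theta> w x \<longleftrightarrow>
     \<theta> \<in> C \<and> w \<in> Hom N N id \<theta> \<and> x \<in> Hom N N \<theta> (\<theta> \<circ> \<theta>) \<and>
     (w\<^sup>\<dagger> \<otimes>\<^bsub>\<theta>\<^esub> 1) * x = 1 \<and> (1 \<otimes>\<^bsub>\<theta>\<^esub> w\<^sup>\<dagger>) * x = 1 \<and>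
     (x \<otimes>\<^bsub>\<theta>\<^esub> 1) * x = (1 \<otimes>\<^bsub>\<theta>\<^esub> x) * x \<and>
     (1 \<otimes>\<^bsub>\<theta>\<^esub> x\<^sup>\<dagger>) * (x \<otimes>\<^bsub>\<theta>\<^esub> 1) = x * x\<^sup>\<dagger> \<and>
     x * x\<^sup>\<dagger> = (x\<^sup>\<dagger> \<otimes>\<^bsub>\<theta> \<circ> \<theta>\<^esub> 1) * (1 \<otimes>\<^bsub>\<theta>\<^esub> x) \<and>
     w\<^sup>\<dagger> * w = complex_of_real (sqrt (hom_dim N N \<theta>)) *\<^sub>B 1 \<and>
     x\<^sup>\<dagger> * x = complex_of_real (sqrt (hom_dim N N \<theta>)) *\<^sub>B 1"

text \<open>\<open>\<iota> : N \<rightarrow> M\<close> together with \<open>v \<in> M\<close> is the extension defined by the Q-system \<open>(\<theta>, w, x)\<close>;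
  \<open>u\<close> is the unit of \<open>M\<close>.\<close>

definition extension_on :: "'h::complex_hilbert bop set \<Rightarrow> ('h bop \<Rightarrow> 'h bop) \<Rightarrow> 'h bop \<Rightarrow> 'h bop
    \<Rightarrow> 'k::complex_hilbert bop \<Rightarrow> 'k bop set \<Rightarrow> ('h bop \<Rightarrow> 'k bop) \<Rightarrow> 'k bop \<Rightarrow> bool" where
  "extension_on N \<theta> w x u M \<iota> v \<longleftrightarrow>
     von_neumann_algebra_on u M \<and> vn_hom_on N u M \<iota> \<and> v \<in> M \<and>
     bij_betw (\<lambda>n. \<iota> n * v) N M \<and>
     (\<forall>n\<in>N. v * \<iota> n = \<iota> (\<theta> n) * v) \<and>
     v * v = \<iota> x * v \<and> v\<^sup>\<dagger> = \<iota> (w\<^sup>\<dagger> * x\<^sup>\<dagger>) * v \<and> u = \<iota> (w\<^sup>\<dagger>) * v"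

abbreviation extension :: "'h::complex_hilbert bop set \<Rightarrow> ('h bop \<Rightarrow> 'h bop) \<Rightarrow> 'h bop \<Rightarrow> 'h bop
    \<Rightarrow> 'k::complex_hilbert bop set \<Rightarrow> ('h bop \<Rightarrow> 'k bop) \<Rightarrow> 'k bop \<Rightarrow> bool" where
  "extension N \<theta> w x M \<iota> v \<equiv> extension_on N \<theta> w x 1 M \<iota> v"

text \<open>This determines the conjugate homomorphism \<open>\<iota>'\<close> on \<open>M\<close>, because every element of \<open>M\<close> is
  of the form \<open>\<iota> n * v\<close> for a unique \<open>n\<close>.\<close>

definition extension_conjugate :: "'h::complex_hilbert bop set \<Rightarrow> ('h bop \<Rightarrow> 'h bop) \<Rightarrow> 'h bop
    \<Rightarrow> ('h bop \<Rightarrow> 'k::complex_hilbert bop) \<Rightarrow> 'k bop \<Rightarrow> ('k bop \<Rightarrow> 'h bop) \<Rightarrow> bool" where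
  "extension_conjugate N \<theta> x \<iota> v \<iota>' \<longleftrightarrow> (\<forall>n\<in>N. \<iota>' (\<iota> n * v) = \<theta> n * x)"


section \<open>The reduced Q-system\<close>

definition red_theta :: "('h::complex_hilbert bop \<Rightarrow> 'h bop) \<Rightarrow> 'h bop \<Rightarrow> 'h bop \<Rightarrow> 'h bop" where
  "red_theta \<theta> S = (\<lambda>n. S\<^sup>\<dagger> * \<theta> n * S)"

definition red_n :: "('h::complex_hilbert bop \<Rightarrow> 'h bop) \<Rightarrow> 'h bop \<Rightarrow> 'h bop \<Rightarrow> 'h bop \<Rightarrow> 'h bop" where
  "red_n \<theta> x P S = S\<^sup>\<dagger> * x\<^sup>\<dagger> * (P \<otimes>\<^bsub>\<theta>\<^esub> P) * x * S"

definition red_w :: "'h::complex_hilbert bop set \<Rightarrow> ('h bop \<Rightarrow> 'h bop) \<Rightarrow> 'h bop \<Rightarrow> 'h bop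
    \<Rightarrow> 'h bop \<Rightarrow> 'h bop \<Rightarrow> 'h bop" where
  "red_w N \<theta> w x P S =
     complex_of_real (hom_dim N N (red_theta \<theta> S) powr (-1/4)) *\<^sub>B
       (sqrt_bop (red_n \<theta> x P S) * S\<^sup>\<dagger> * w)"

definition red_x :: "'h::complex_hilbert bop set \<Rightarrow> ('h bop \<Rightarrow> 'h bop) \<Rightarrow> 'h bop
    \<Rightarrow> 'h bop \<Rightarrow> 'h bop \<Rightarrow> 'h bop" where
  "red_x N \<theta> x P S =
     (let r = sqrt_bop (red_n \<theta> x P S); t = inverse_bop r * S\<^sup>\<dagger> in
      complex_of_real (hom_dim N N (red_theta \<theta> S) powr (1/4)) *\<^sub>B
        ((t \<otimes>\<^bsub>\<theta>\<^esub> t) * x * S * r))"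

end

theory Submission
  imports Defs
begin

text \<open>The isometry \<open>S\<close> intertwines \<open>\<theta>\<^sub>P\<close> with \<open>\<theta>\<close>, and the relations for \<open>P\<close> say that
  \<open>S\<^sup>\<dagger>w\<close> and \<open>(S\<^sup>\<dagger> \<times> S\<^sup>\<dagger>)xS\<close> satisfy the unit, associativity and Frobenius relations. What
  remains is the normalization, that is, \<open>dim \<theta>\<^sub>P = d\<^sub>A \<cdot> w\<^sup>\<dagger>Pw\<close>. The conjugate pair
  \<open>R\<^sub>P = x\<^sub>Pw\<^sub>P\<close> gives \<open>\<le>\<close>. For \<open>\<ge>\<close>, any conjugate pair for \<open>\<theta>\<^sub>P\<close> of value \<open>d\<close> is completed
  to one for \<open>\<theta>\<close> of value \<open>d + d\<^sub>A \<cdot> w\<^sup>\<dagger>(1 - P)w\<close>, which is at least \<open>dim \<theta> = d\<^sub>A \<cdot> w\<^sup>\<dagger>w\<close>.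
  In the extension, \<open>e = \<iota>(w\<^sup>\<dagger>P)v\<close>, and \<open>\<iota>(n)v \<mapsto> \<iota>(nP)v\<close> is multiplication by \<open>e\<close> on either
  side, which makes \<open>e\<close> central.\<close>

section \<open>Adjoints\<close>

text \<open>The source of all adjoints: \<open>adj\<close> is a definite description and carries
  meaning only once representing vectors exist. Stated for the real scalar product, from which norm
  and completeness come.\<close>

lemma Riesz_representation:
  fixes f :: "'a::{real_inner, complete_space} \<Rightarrow> real"
  assumes "bounded_linear f"
  obtains z where "\<And>x. f x = inner z x"
proof -
  interpret f: bounded_linear f by fact
  \<comment> \<open>The representing vector is the minimum of this strictly convex functional.\<close>
  define \<phi> where "\<phi> x = inner x x - 2 * f x" for x
  obtain K where K: "\<And>x. norm (f x) \<le> norm x * K"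
    using f.bounded by blast
  \<comment> \<open>Boundedness of \<open>f\<close> and completing the square in
    \<open>norm x\<close>.\<close>
  have lower: "- K\<^sup>2 \<le> \<phi> x" for x
  proof -
    have "f x \<le> norm x * K"
      using K[of x] by simp
    moreover have "0 \<le> (norm x - K)\<^sup>2"
      by simp
    ultimately show ?thesis
      by (simp add: \<phi>_def power2_norm_eq_inner[symmetric] power2_eq_square algebra_simps)
  qed
  define m where "m = Inf (range \<phi>)"
  have bdd: "bdd_below (range \<phi>)"
    by (rule bdd_belowI2) (rule lower)
  have m_le: "m \<le> \<phi> x" for x
    unfolding m_def using bdd by (auto intro: cInf_lower)
  have "\<exists>x. \<phi> x < m + inverse (real (Suc n))" for n
  proof -
    have "Inf (range \<phi>) < m + inverse (real (Suc n))"
      by (simp add: m_def)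
    thus ?thesis
      using cInf_less_iff[OF _ bdd] by auto
  qed
  then obtain X where X: "\<And>n. \<phi> (X n) < m + inverse (real (Suc n))"
    by metis
  \<comment> \<open>Parallelogram law, with \<open>m_le\<close> applied at the midpoint: two
    near-minimizers are close to each other, so a minimizing sequence is Cauchy.\<close>
  have midpoint: "(norm (x - y))\<^sup>2 \<le> 2 * (\<phi> x - m) + 2 * (\<phi> y - m)" for x y
  proof -
    have "(norm (x - y))\<^sup>2 = 2 * \<phi> x + 2 * \<phi> y - 4 * \<phi> ((1/2) *\<^sub>R (x + y))"
      unfolding power2_norm_eq_inner \<phi>_def f.scaleR f.add
      by (simp add: inner_add_left inner_add_right inner_diff_left inner_diff_right inner_commute
          field_simps)
    with m_le[of "(1/2) *\<^sub>R (x + y)"] show ?thesis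
      by simp
  qed
  have "Cauchy X"
  proof (rule CauchyI)
    fix \<epsilon> :: real assume "0 < \<epsilon>"
    hence "0 < \<epsilon>\<^sup>2 / 4" by simp
    then obtain k where k: "inverse (real (Suc k)) < \<epsilon>\<^sup>2 / 4"
      using reals_Archimedean by blast
    have near: "\<phi> (X i) - m < \<epsilon>\<^sup>2 / 4" if "k \<le> i" for i
    proof -
      have "inverse (real (Suc i)) \<le> inverse (real (Suc k))"
        using that by (auto intro!: le_imp_inverse_le)
      also note k
      finally have "m + inverse (real (Suc i)) < m + \<epsilon>\<^sup>2 / 4"
        by simp
      with X[of i] show ?thesis
        by simp
    qed
    have "norm (X i - X j) < \<epsilon>" if "k \<le> i" "k \<le> j" for i j
    proof -
      have "(norm (X i - X j))\<^sup>2 < \<epsilon>\<^sup>2"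
        using midpoint[of "X i" "X j"] near[OF that(1)] near[OF that(2)]
        by (simp add: field_simps)
      thus ?thesis
        using \<open>0 < \<epsilon>\<close> by (simp add: power2_less_imp_less)
    qed
    thus "\<exists>k. \<forall>i\<ge>k. \<forall>j\<ge>k. norm (X i - X j) < \<epsilon>" by blast
  qed
  then obtain z where z: "X \<longlonglongrightarrow> z"
    using Cauchy_convergent convergent_def by blast
  have "(\<lambda>n. \<phi> (X n)) \<longlonglongrightarrow> \<phi> z"
    unfolding \<phi>_def by (intro tendsto_intros z f.tendsto)
  moreover have "(\<lambda>n. m + inverse (real (Suc n))) \<longlonglongrightarrow> m + 0"
    by (intro tendsto_intros LIMSEQ_inverse_real_of_nat)
  ultimately have "\<phi> z \<le> m + 0"
    by (rule LIMSEQ_le) (use X in \<open>auto intro: less_imp_le\<close>)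
  hence min: "\<phi> z \<le> \<phi> x" for x
    using m_le[of x] by simp
  have "f y = inner z y" for y
  proof (cases "y = 0")
    case False
    define b where "b = inner z y - f y"
    \<comment> \<open>The minimizer of the quadratic
      \<open>2 * t * b + t\<^sup>2 * inner y y\<close>; minimality at \<open>z\<close> then forces
      \<open>b = 0\<close>.\<close>
    define t where "t = - b / inner y y"
    have "\<phi> (z + t *\<^sub>R y) - \<phi> z = 2 * t * b + t\<^sup>2 * inner y y"
      unfolding \<phi>_def b_def f.scaleR f.add
      by (simp add: inner_add_left inner_add_right inner_commute algebra_simps power2_eq_square)
    also have "\<dots> = - b\<^sup>2 / inner y y"
      using False by (simp add: t_def power2_eq_square)
    finally have "b\<^sup>2 / inner y y \<le> 0"
      using min[of "z + t *\<^sub>R y"] by simp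
    moreover have "0 < inner y y"
      using False by simp
    ultimately have "b\<^sup>2 \<le> 0"
      by (simp add: divide_le_0_iff)
    thus ?thesis
      by (simp add: b_def)
  qed (simp add: f.zero)
  thus thesis by (rule that)
qed

section \<open>The complex scalar product in terms of the real one\<close>

lemma cinner_diff_right: "cinner x (y - z) = cinner x y - cinner x z"
  using cinner_add_right[of x "y - z" z] by simp

lemma cinner_add_left: "cinner (x + y) z = cinner x z + cinner y z"
  by (metis cinner_add_right cinner_commute complex_cnj_add)

lemma cinner_scaleC_left: "cinner (c *\<^sub>C x) z = cnj c * cinner x z"
  by (metis cinner_scaleC_right cinner_commute complex_cnj_mult)

lemma Im_cinner: "Im (cinner x y) = inner (\<i> *\<^sub>C x) y"
  by (simp add: inner_eq_Re_cinner cinner_scaleC_left)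

text \<open>Transfers identities from the real to the complex product: it is enough to test a real
  identity at \<open>x\<close> and at \<open>\<i> *\<^sub>C x\<close>.\<close>

lemma cinner_eq_inner: "cinner x y = Complex (inner x y) (inner (\<i> *\<^sub>C x) y)"
  unfolding complex_eq_iff Im_cinner by (simp add: inner_eq_Re_cinner)

lemma cinner_self: "cinner x x = complex_of_real ((norm x)\<^sup>2)"
proof -
  have "Im (cinner x x) = 0"
    using cinner_commute[of x x] by (simp add: complex_eq_iff)
  thus ?thesis
    by (simp add: complex_eq_iff inner_eq_Re_cinner power2_norm_eq_inner)
qed

lemma cinner_eqI:
  assumes "\<And>x. cinner x y = cinner x z"
  shows "y = z"
proof -
  have "cinner (y - z) (y - z) = 0"
    by (simp add: cinner_diff_right assms)
  thus ?thesis
    by (simp add: cinner_self)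
qed

section \<open>Bounded operators and their adjoints\<close>

lemma bounded_linear_app: "bounded_linear (app T)"
  and app_scaleC: "app T (c *\<^sub>C x) = c *\<^sub>C app T x"
  using app[of T] by auto

lemma app_add [simp]: "app (S + T) x = app S x + app T x"
  by transfer simp

lemma app_times [simp]: "app (S * T) x = app S (app T x)"
  by transfer simp

lemma app_one [simp]: "app 1 x = x"
  by transfer simp

lemma app_zero [simp]: "app 0 x = 0"
  by transfer simp

lemma app_scale [simp]: "app (c *\<^sub>B T) x = c *\<^sub>C app T x"
  by transfer simp

lemma bop_eqI: "(\<And>x. app S x = app T x) \<Longrightarrow> S = T"
  by (simp add: app_inject[symmetric] fun_eq_iff)

text \<open>For fixed \<open>y\<close>, Riesz represents the functional
  \<open>inner y (app T x)\<close> of \<open>x\<close> by a vector \<open>g y\<close>. Uniqueness of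
  the representing vector makes \<open>g\<close> linear, and evaluation at \<open>x = g y\<close>
  bounds \<open>g\<close> by the bound of \<open>T\<close>.\<close>

lemma adjoint_exists:
  fixes T :: "'h::complex_hilbert bop"
  shows "\<exists>R. \<forall>x y. cinner (app T x) y = cinner x (app R y)"
proof -
  have "\<exists>z. \<forall>x. inner y (app T x) = inner z x" for y
    using Riesz_representation[OF bounded_linear_compose[OF bounded_linear_inner_right bounded_linear_app]]
    by metis
  then obtain g where g: "\<And>x y. inner y (app T x) = inner (g y) x"
    by metis
  have *: "cinner (app T x) y = cinner x (g y)" for x y
    using g[of y x] g[of y "\<i> *\<^sub>C x"]
    by (simp add: cinner_eq_inner app_scaleC inner_commute)
  have add: "g (y + z) = g y + g z" for y z
    by (rule cinner_eqI) (metis * cinner_add_right)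
  have scale: "g (c *\<^sub>C y) = c *\<^sub>C g y" for c y
    by (rule cinner_eqI) (metis * cinner_scaleC_right)
  obtain K where K: "\<And>x. norm (app T x) \<le> norm x * K" "0 \<le> K"
    using bounded_linear.nonneg_bounded[OF bounded_linear_app, of T] by blast
  have "bounded_linear g"
  proof (rule bounded_linear_intro)
    show "g (r *\<^sub>R y) = r *\<^sub>R g y" for r y
      by (simp add: scaleR_scaleC scale)
    show "norm (g y) \<le> norm y * K" for y
    proof (cases "norm (g y) = 0")
      case False
      have "norm (g y) * norm (g y) = inner y (app T (g y))"
        by (simp add: g power2_norm_eq_inner flip: power2_eq_square)
      also have "\<dots> \<le> norm y * (norm (g y) * K)"
        by (intro order_trans[OF norm_cauchy_schwarz] mult_left_mono K) simp
      finally have "norm (g y) * norm (g y) \<le> norm (g y) * (norm y * K)"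
        by (simp add: mult_ac)
      with False show ?thesis
        by (simp add: mult_le_cancel_left)
    qed (use K in auto)
  qed (rule add)
  hence "app (Abs_bop g) = g"
    by (intro Abs_bop_inverse) (simp add: scale)
  with * show ?thesis
    by metis
qed

text \<open>Makes \<open>adj\<close> computable: most rules below just exhibit an operator with the
  defining property.\<close>

lemma adj_unique:
  assumes "\<And>x y. cinner (app T x) y = cinner x (app R y)"
  shows "T\<^sup>\<dagger> = R"
  unfolding adj_def
proof (rule the_equality)
  fix R' assume "\<forall>x y. cinner (app T x) y = cinner x (app R' y)"
  hence "cinner x (app R' y) = cinner x (app R y)" for x y
    using assms by simp
  thus "R' = R"
    by (blast intro: bop_eqI cinner_eqI)
qed (use assms in blast)

lemma cinner_adj: "cinner (app T x) y = cinner x (app (T\<^sup>\<dagger>) y)"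
  using adjoint_exists[of T] adj_unique by metis

lemma cinner_adj': "cinner (app (T\<^sup>\<dagger>) x) y = cinner x (app T y)"
  by (metis cinner_adj cinner_commute)

lemma adj_adj [simp]: "(T\<^sup>\<dagger>)\<^sup>\<dagger> = T"
  by (rule adj_unique) (rule cinner_adj')

lemma adj_mult [simp]: "(S * T)\<^sup>\<dagger> = T\<^sup>\<dagger> * S\<^sup>\<dagger>"
  by (rule adj_unique) (simp add: cinner_adj)

lemma adj_one [simp]: "1\<^sup>\<dagger> = 1"
  by (rule adj_unique) simp

lemma adj_add [simp]: "(S + T)\<^sup>\<dagger> = S\<^sup>\<dagger> + T\<^sup>\<dagger>"
  by (rule adj_unique) (simp add: cinner_adj cinner_add_left cinner_add_right)

lemma adj_diff [simp]: "(S - T)\<^sup>\<dagger> = S\<^sup>\<dagger> - T\<^sup>\<dagger>"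
  using adj_add[of "S - T" T] by (simp del: adj_add)

lemma adj_scale [simp]: "(c *\<^sub>B T)\<^sup>\<dagger> = cnj c *\<^sub>B T\<^sup>\<dagger>"
  by (rule adj_unique) (simp add: cinner_adj cinner_scaleC_left cinner_scaleC_right)

lemma scale_mult_left [simp]: "(c *\<^sub>B S) * T = c *\<^sub>B (S * T)"
  by (rule bop_eqI) simp

lemma scale_mult_right [simp]: "S * (c *\<^sub>B T) = c *\<^sub>B (S * T)"
  by (rule bop_eqI) (simp add: app_scaleC)

lemma scale_scale [simp]: "a *\<^sub>B b *\<^sub>B T = (a * b) *\<^sub>B T"
  by (rule bop_eqI) (simp add: scaleC_scaleC)

lemma scaleC_one [simp]: "1 *\<^sub>C (x :: 'h::complex_hilbert) = x"
  using scaleR_scaleC[of 1 x] by simp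

lemma scale_one [simp]: "1 *\<^sub>B T = T"
  by (rule bop_eqI) simp

lemma scale_add_left: "(a + b) *\<^sub>B T = a *\<^sub>B T + b *\<^sub>B T"
  by (rule bop_eqI) (simp add: scaleC_add_left)

lemma scale_add_right: "c *\<^sub>B (S + T) = c *\<^sub>B S + c *\<^sub>B T"
  by (rule bop_eqI) (simp add: scaleC_add_right)

lemma scale_diff_right: "c *\<^sub>B (S - T) = c *\<^sub>B S - c *\<^sub>B T"
  using scale_add_right[of c "S - T" T] by (simp add: eq_diff_eq)

lemma scale_zero_left [simp]: "0 *\<^sub>B T = 0"
  using scale_add_left[of 0 0 T] by simp

section \<open>Positivity, and square roots and inverses of scalars\<close>

lemma norm_app_adj_mult: "cinner x (app (T\<^sup>\<dagger> * T) x) = complex_of_real ((norm (app T x))\<^sup>2)"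
  by (simp add: cinner_adj[symmetric] cinner_self)

lemma adj_mult_self_eq_0: "T\<^sup>\<dagger> * T = 0 \<Longrightarrow> T = 0"
proof (rule bop_eqI)
  fix x assume "T\<^sup>\<dagger> * T = 0"
  hence "cinner x (app (0 :: 'a bop) x) = complex_of_real ((norm (app T x))\<^sup>2)"
    by (metis norm_app_adj_mult)
  thus "app T x = app 0 x"
    using cinner_scaleC_right[of x 0 0] cinner_diff_right[of x 0 0] by simp
qed

text \<open>At a nonzero vector, \<open>c\<close> is the quotient of the squared norms of
  \<open>app T x\<close> and \<open>x\<close>. This makes the values of conjugate pairs
  nonnegative.\<close>

lemma adj_mult_self_scalar:
  fixes T :: "'h::complex_hilbert bop"
  assumes "T\<^sup>\<dagger> * T = c *\<^sub>B 1" and "(1 :: 'h bop) \<noteq> 0"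
  shows "Im c = 0" "0 \<le> Re c"
proof -
  obtain x :: 'h where x: "x \<noteq> 0"
    using assms(2) bop_eqI[of 1 "0 :: 'h bop"] by auto
  have "c * complex_of_real ((norm x)\<^sup>2) = complex_of_real ((norm (app T x))\<^sup>2)"
    using norm_app_adj_mult[of x T] assms(1) by (simp add: cinner_scaleC_right cinner_self)
  hence "c = complex_of_real ((norm (app T x))\<^sup>2 / (norm x)\<^sup>2)"
    using x by (simp add: field_simps)
  thus "Im c = 0" "0 \<le> Re c"
    by auto
qed

text \<open>For uniqueness, factor \<open>R * R - r\<close> into \<open>R + sqrt r\<close> and
  \<open>R - sqrt r\<close>. Every vector in the range of the second factor is killed by the first,
  which is strictly positive because \<open>R\<close> is positive.\<close>

lemma sqrt_bop_scalar:
  assumes "0 < r"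
  shows "sqrt_bop (complex_of_real r *\<^sub>B 1) = complex_of_real (sqrt r) *\<^sub>B (1 :: 'h::complex_hilbert bop)"
  unfolding sqrt_bop_def
proof (rule the_equality)
  let ?s = "complex_of_real (sqrt r)"
  have ss: "?s * ?s = complex_of_real r"
    using assms by (simp flip: of_real_mult)
  show "positive (?s *\<^sub>B (1 :: 'h bop)) \<and> ?s *\<^sub>B (1 :: 'h bop) * ?s *\<^sub>B 1 = complex_of_real r *\<^sub>B 1"
    using assms by (simp add: positive_def cinner_scaleC_right cinner_self ss del: of_real_power)
  fix R :: "'h bop" assume R: "positive R \<and> R * R = complex_of_real r *\<^sub>B 1"
  show "R = ?s *\<^sub>B 1"
  proof (rule bop_eqI)
    fix x
    define y where "y = app (R - ?s *\<^sub>B 1) x"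
    have "(R + ?s *\<^sub>B 1) * (R - ?s *\<^sub>B 1) = 0"
      using R by (simp add: distrib_left distrib_right left_diff_distrib right_diff_distrib
            scale_add_right ss)
    hence "app R y + ?s *\<^sub>C y = 0"
      unfolding y_def by (metis app_add app_one app_scale app_times app_zero)
    hence "cinner y (app R y) + ?s * complex_of_real ((norm y)\<^sup>2) = 0"
      using cinner_add_right[of y "app R y" "?s *\<^sub>C y"] cinner_diff_right[of y 0 0]
      by (simp add: cinner_scaleC_right cinner_self)
    hence "Re (cinner y (app R y)) + sqrt r * (norm y)\<^sup>2 = 0"
      by (simp add: complex_eq_iff)
    moreover have "0 \<le> Re (cinner y (app R y))"
      using R by (simp add: positive_def)
    moreover have "0 < sqrt r"
      using assms by simp
    ultimately have "y = 0"
      by (smt (verit) mult_pos_pos power2_less_eq_zero_iff zero_less_power norm_ge_zero zero_less_norm_iff)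
    moreover have "app R x = y + app (?s *\<^sub>B 1) x"
      using app_add[of "R - ?s *\<^sub>B 1" "?s *\<^sub>B 1" x] by (simp add: y_def)
    ultimately show "app R x = app (?s *\<^sub>B 1) x"
      by simp
  qed
qed

lemma inverse_bop_scalar:
  assumes "c \<noteq> 0"
  shows "inverse_bop (c *\<^sub>B 1) = inverse c *\<^sub>B (1 :: 'h::complex_hilbert bop)"
  unfolding inverse_bop_def
proof (rule the_equality)
  fix R :: "'h bop" assume "R * c *\<^sub>B 1 = 1 \<and> c *\<^sub>B 1 * R = 1"
  hence "inverse c *\<^sub>B (c *\<^sub>B R) = inverse c *\<^sub>B 1"
    by simp
  thus "R = inverse c *\<^sub>B 1"
    using assms by simp
qed (use assms in simp)

section \<open>Reduction of the algebraic structure\<close>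

text \<open>Lets a rule for \<open>a * b\<close> rewrite inside right-associated products, as
  \<open>rule[THEN mult_ext]\<close>.\<close>

lemma mult_ext: "a * b = c \<Longrightarrow> a * (b * d) = c * (d :: 'a::semigroup_mult)"
  by (simp add: mult.assoc[symmetric])

lemma commutant_iff: "T \<in> commutant A \<longleftrightarrow> (\<forall>a\<in>A. T * a = a * T)"
  by (simp add: commutant_on_def)

section \<open>Membership in von Neumann algebras and rules for homomorphisms\<close>

locale vn_algebra =
  fixes N :: "'h::complex_hilbert bop set"
  assumes vna: "von_neumann_algebra N"
begin

text \<open>The bicommutant condition as an introduction rule; closure under sums, products and
  scalars follows from it.\<close>

lemma memI: "(\<And>T. T \<in> commutant N \<Longrightarrow> a * T = T * a) \<Longrightarrow> a \<in> N"
  using vna commutant_iff unfolding von_neumann_algebra_on_def by blast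

lemma commutes: "a \<in> N \<Longrightarrow> T \<in> commutant N \<Longrightarrow> a * T = T * a"
  by (simp add: commutant_iff)

lemma one_mem [simp]: "1 \<in> N"
  by (rule memI) simp

lemma mult_mem [simp]: "a \<in> N \<Longrightarrow> b \<in> N \<Longrightarrow> a * b \<in> N"
  by (rule memI) (metis commutes mult.assoc)

lemma add_mem [simp]: "a \<in> N \<Longrightarrow> b \<in> N \<Longrightarrow> a + b \<in> N"
  by (rule memI) (simp add: commutes distrib_left distrib_right)

lemma diff_mem [simp]: "a \<in> N \<Longrightarrow> b \<in> N \<Longrightarrow> a - b \<in> N"
  by (rule memI) (simp add: commutes left_diff_distrib right_diff_distrib)

lemma scale_mem [simp]: "a \<in> N \<Longrightarrow> c *\<^sub>B a \<in> N"
  by (rule memI) (simp add: commutes)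

lemma adj_mem [simp]: "a \<in> N \<Longrightarrow> a\<^sup>\<dagger> \<in> N"
  using vna by (simp add: von_neumann_algebra_on_def)

end

locale vn_homomorphism = vn_algebra N
  for N :: "'h::complex_hilbert bop set" +
  fixes u :: "'k::complex_hilbert bop" and M :: "'k bop set" and \<alpha> :: "'h bop \<Rightarrow> 'k bop"
  assumes hom: "vn_hom_on N u M \<alpha>"
begin

lemma hom_mem [simp]: "n \<in> N \<Longrightarrow> \<alpha> n \<in> M"
  and hom_one [simp]: "\<alpha> 1 = u"
  and hom_add: "m \<in> N \<Longrightarrow> n \<in> N \<Longrightarrow> \<alpha> (m + n) = \<alpha> m + \<alpha> n"
  and hom_mult: "m \<in> N \<Longrightarrow> n \<in> N \<Longrightarrow> \<alpha> (m * n) = \<alpha> m * \<alpha> n"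
  and hom_scale: "n \<in> N \<Longrightarrow> \<alpha> (c *\<^sub>B n) = c *\<^sub>B \<alpha> n"
  and hom_adj: "n \<in> N \<Longrightarrow> \<alpha> (n\<^sup>\<dagger>) = (\<alpha> n)\<^sup>\<dagger>"
  using hom by (auto simp: vn_hom_on_def)

lemma hom_zero [simp]: "\<alpha> 0 = 0"
  using hom_scale[of 1 0] by simp

lemma hom_diff: "m \<in> N \<Longrightarrow> n \<in> N \<Longrightarrow> \<alpha> (m - n) = \<alpha> m - \<alpha> n"
  using hom_add[of "m - n" n] by simp

end

text \<open>A Q-system stripped of its normalization, with the products by \<open>1\<close>
  evaluated. The reduction preserves these relations as they stand; the scalars are adjusted only at
  the end.\<close>

definition frobenius :: "'h::complex_hilbert bop set \<Rightarrow> ('h bop \<Rightarrow> 'h bop) \<Rightarrow> 'h bop \<Rightarrow> 'h bop \<Rightarrow> bool" where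
  "frobenius N \<theta> w x \<longleftrightarrow>
     w \<in> Hom N N id \<theta> \<and> x \<in> Hom N N \<theta> (\<theta> \<circ> \<theta>) \<and>
     w\<^sup>\<dagger> * x = 1 \<and> \<theta> (w\<^sup>\<dagger>) * x = 1 \<and> x * x = \<theta> x * x \<and>
     \<theta> (x\<^sup>\<dagger>) * x = x * x\<^sup>\<dagger> \<and> x\<^sup>\<dagger> * \<theta> x = x * x\<^sup>\<dagger>"

lemma Q_system_iff_frobenius:
  assumes "\<theta> 1 = 1"
  shows "Q_system N C \<theta> w x \<longleftrightarrow> \<theta> \<in> C \<and> frobenius N \<theta> w x \<and>
     w\<^sup>\<dagger> * w = complex_of_real (sqrt (hom_dim N N \<theta>)) *\<^sub>B 1 \<and>
     x\<^sup>\<dagger> * x = complex_of_real (sqrt (hom_dim N N \<theta>)) *\<^sub>B 1"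
  by (auto simp: Q_system_def frobenius_def hprod_def assms)

locale vn_endomorphism = vn_homomorphism N 1 N \<theta>
  for N :: "'h::complex_hilbert bop set" and \<theta>
begin

lemma hom_intertwiner_adj:
  assumes "t \<in> N" "n \<in> N" "t * m\<^sup>\<dagger> = \<theta> (n\<^sup>\<dagger>) * t"
  shows "t\<^sup>\<dagger> * \<theta> n = m * t\<^sup>\<dagger>"
  using assms by (metis adj_adj adj_mult hom_adj adj_mem)

end

section \<open>Frobenius relations and self-conjugacy\<close>

locale frobenius_endomorphism = vn_endomorphism +
  fixes w x
  assumes frob: "frobenius N \<theta> w x"
begin

lemma w_mem [simp]: "w \<in> N"
  and x_mem [simp]: "x \<in> N"
  and w_intertwines: "n \<in> N \<Longrightarrow> w * n = \<theta> n * w"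
  and x_intertwines: "n \<in> N \<Longrightarrow> x * \<theta> n = \<theta> (\<theta> n) * x"
  and unit_left: "w\<^sup>\<dagger> * x = 1"
  and unit_right: "\<theta> (w\<^sup>\<dagger>) * x = 1"
  and assoc: "x * x = \<theta> x * x"
  and frobenius_right: "\<theta> (x\<^sup>\<dagger>) * x = x * x\<^sup>\<dagger>"
  and frobenius_left: "x\<^sup>\<dagger> * \<theta> x = x * x\<^sup>\<dagger>"
  using frob by (auto simp: frobenius_def Hom_def)

lemma w_adj_intertwines: "n \<in> N \<Longrightarrow> w\<^sup>\<dagger> * \<theta> n = n * w\<^sup>\<dagger>"
  by (rule hom_intertwiner_adj) (simp_all add: w_intertwines)

lemma x_adj_intertwines: "n \<in> N \<Longrightarrow> x\<^sup>\<dagger> * \<theta> (\<theta> n) = \<theta> n * x\<^sup>\<dagger>"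
  by (rule hom_intertwiner_adj) (simp_all add: x_intertwines flip: hom_adj)

lemma unit_left_adj: "x\<^sup>\<dagger> * w = 1"
  using arg_cong[OF unit_left, of adj] by simp

lemma unit_right_adj: "x\<^sup>\<dagger> * \<theta> w = 1"
  using arg_cong[OF unit_right, of adj] by (simp add: hom_adj)

text \<open>A Frobenius relation turns the inner pair of \<open>x\<close> factors into
  \<open>x * x\<^sup>\<dagger>\<close>, after which the unit relations contract each side to
  \<open>1\<close>.\<close>

lemma self_conjugate: "conjugate_pair N N \<theta> \<theta> (x * w) (x * w)"
proof -
  have "x * w * n = \<theta> (\<theta> n) * (x * w)" if "n \<in> N" for n
    using that by (simp add: mult.assoc w_intertwines x_intertwines[THEN mult_ext])
  moreover have "(x * w)\<^sup>\<dagger> * \<theta> (x * w) = 1"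
    by (simp add: hom_mult mult.assoc frobenius_left[THEN mult_ext] unit_right_adj unit_left)
  moreover have "\<theta> ((x * w)\<^sup>\<dagger>) * (x * w) = 1"
    by (simp add: hom_mult mult.assoc frobenius_right[THEN mult_ext] unit_left_adj unit_right)
  ultimately show ?thesis
    by (simp add: conjugate_pair_def Hom_def)
qed

text \<open>The unit relations have degree one in \<open>w\<close> and in \<open>x\<close>, and the
  others are homogeneous in \<open>x\<close>. So one real scale is free, to be fixed by the
  normalization.\<close>

lemma frobenius_rescale:
  assumes "r \<noteq> (0 :: real)"
  shows "frobenius N \<theta> (complex_of_real r *\<^sub>B w) (complex_of_real (inverse r) *\<^sub>B x)"
  using frob assms
  by (auto simp: frobenius_def Hom_def hom_scale simp flip: of_real_mult)

end

lemma isometry_cancel: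
  assumes "isometry T" "T * a = T * b"
  shows "a = b"
  using assms by (metis isometry_def mult.assoc mult_1)

section \<open>Compression by the isometry \<open>S\<close>\<close>

locale frobenius_reduction = frobenius_endomorphism +
  fixes P S
  assumes P_mem [simp]: "P \<in> N"
    and P_commutes: "n \<in> N \<Longrightarrow> P * \<theta> n = \<theta> n * P"
    and P_projection: "projection P"
    and theta_P_x: "\<theta> P * x = x * P"
    and P_x: "P * x = x * P"
    and S_mem [simp]: "S \<in> N"
    and S_isometry: "S\<^sup>\<dagger> * S = 1"
    and S_range: "S * S\<^sup>\<dagger> = P"
begin

abbreviation "\<rho> \<equiv> red_theta \<theta> S"

lemma P_adj [simp]: "P\<^sup>\<dagger> = P" and P_idem: "P * P = P"
  using P_projection by (auto simp: projection_def)

lemma P_S: "P * S = S" and S_adj_P: "S\<^sup>\<dagger> * P = S\<^sup>\<dagger>"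
  by (simp_all add: S_range[symmetric] mult.assoc S_isometry S_isometry[THEN mult_ext])

lemma S_intertwines: "n \<in> N \<Longrightarrow> S * \<rho> n = \<theta> n * S"
  by (simp add: red_theta_def mult.assoc S_range[THEN mult_ext] P_commutes[THEN mult_ext] P_S)

lemma S_adj_intertwines: "n \<in> N \<Longrightarrow> S\<^sup>\<dagger> * \<theta> n = \<rho> n * S\<^sup>\<dagger>"
  by (simp add: red_theta_def mult.assoc S_range S_adj_P[THEN mult_ext] flip: P_commutes)

sublocale rho: vn_endomorphism N "red_theta \<theta> S"
proof
  have "S\<^sup>\<dagger> * \<theta> m * \<theta> n * S = \<rho> m * \<rho> n" if "m \<in> N" "n \<in> N" for m n
    using that by (simp add: mult.assoc flip: S_intertwines)
      (simp add: mult.assoc[symmetric] S_adj_intertwines, simp add: mult.assoc S_isometry[THEN mult_ext])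
  thus "vn_hom N N (red_theta \<theta> S)"
    unfolding vn_hom_on_def
    by (auto simp: red_theta_def mult.assoc S_isometry hom_add distrib_left distrib_right hom_mult hom_scale hom_adj)
qed

text \<open>The reduced intertwiners up to scalars: \<open>red_w\<close> and \<open>red_x\<close>
  will be \<open>r\<close> and \<open>inverse r\<close> times these.\<close>

definition "w\<^sub>1 = S\<^sup>\<dagger> * w"
definition "x\<^sub>1 = S\<^sup>\<dagger> * \<theta> (S\<^sup>\<dagger>) * x * S"

lemma w1_mem [simp]: "w\<^sub>1 \<in> N" and x1_mem [simp]: "x\<^sub>1 \<in> N"
  by (simp_all add: w\<^sub>1_def x\<^sub>1_def)

lemma theta_range: "\<theta> S * \<theta> (S\<^sup>\<dagger>) = \<theta> P"
  by (simp add: S_range flip: hom_mult)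

text \<open>Since \<open>\<theta> S * S\<close> is the product of \<open>S\<close> with itself, this
  says that \<open>S\<close> respects the comultiplications. The range projections on both legs move
  through \<open>x\<close> to its source and are absorbed by \<open>S\<close>.\<close>

lemma x_S: "\<theta> S * (S * x\<^sub>1) = x * S"
  unfolding x\<^sub>1_def
  by (simp add: mult.assoc S_range[THEN mult_ext] P_commutes[THEN mult_ext] theta_range[THEN mult_ext]
      P_x[THEN mult_ext] theta_P_x[THEN mult_ext] P_S)

lemma S_adj_x: "S\<^sup>\<dagger> * (\<theta> (S\<^sup>\<dagger>) * x) = x\<^sub>1 * S\<^sup>\<dagger>"
  unfolding x\<^sub>1_def
  by (simp add: mult.assoc S_range flip: P_x)
    (simp add: P_commutes[symmetric, THEN mult_ext] mult.assoc S_adj_P[THEN mult_ext])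

lemma x_adj_S: "x\<^sup>\<dagger> * (\<theta> S * S) = S * x\<^sub>1\<^sup>\<dagger>"
  using arg_cong[OF S_adj_x, of adj] by (simp add: hom_adj mult.assoc)

lemma S_isometry': "isometry S" "isometry (\<theta> S * S)" "isometry (\<theta> (\<theta> S) * (\<theta> S * S))"
proof -
  have 1: "(\<theta> S)\<^sup>\<dagger> * \<theta> S = 1"
    using hom_mult[of "S\<^sup>\<dagger>" S] by (simp add: S_isometry hom_adj)
  have 2: "(\<theta> (\<theta> S))\<^sup>\<dagger> * \<theta> (\<theta> S) = 1"
    using hom_mult[of "(\<theta> S)\<^sup>\<dagger>" "\<theta> S"] by (simp add: 1 hom_adj)
  show "isometry S" "isometry (\<theta> S * S)" "isometry (\<theta> (\<theta> S) * (\<theta> S * S))"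
    by (simp_all add: isometry_def mult.assoc 2[THEN mult_ext] 1[THEN mult_ext] S_isometry)
qed

text \<open>Each identity is checked after composing with an isometry \<open>S\<close>, \<open>\<theta>(S)S\<close> or \<open>\<theta>\<^sup>2(S)\<theta>(S)S\<close>,
  which transports it to the corresponding identity of the original system.\<close>

lemma frobenius_reduced: "frobenius N \<rho> w\<^sub>1 x\<^sub>1"
proof -
  have w1: "w\<^sub>1 * n = \<rho> n * w\<^sub>1" if "n \<in> N" for n
    using that unfolding w\<^sub>1_def
    by (simp add: mult.assoc w_intertwines S_adj_intertwines[THEN mult_ext])
  have S_ext: "S * (\<rho> n * y) = \<theta> n * (S * y)" if "n \<in> N" for n y
    using S_intertwines[THEN mult_ext] that by (simp add: mult.assoc)
  have x_S_ext: "\<theta> S * (S * (x\<^sub>1 * y)) = x * (S * y)" for y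
    using arg_cong[OF x_S, of "\<lambda>z. z * y"] by (simp add: mult.assoc)
  have theta_ext: "\<theta> a * (\<theta> b * y) = \<theta> (a * b) * y" if "a \<in> N" "b \<in> N" for a b y
    using that by (simp add: hom_mult mult.assoc)
  have x_ext: "\<theta> (\<theta> n) * (x * y) = x * (\<theta> n * y)" if "n \<in> N" for n y
    using x_intertwines[OF that, THEN mult_ext, of y] by (simp add: mult.assoc)
  have x1: "x\<^sub>1 * \<rho> n = \<rho> (\<rho> n) * x\<^sub>1" if n: "n \<in> N" for n
  proof (rule isometry_cancel[OF S_isometry'(2)])
    have "\<theta> S * S * (\<rho> (\<rho> n) * x\<^sub>1) = \<theta> (S * \<rho> n) * (S * x\<^sub>1)"
      using n by (simp add: mult.assoc S_ext theta_ext)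
    also have "\<dots> = \<theta> (\<theta> n) * (x * S)"
      using n by (simp add: S_intertwines hom_mult mult.assoc x_S)
    also have "\<dots> = \<theta> S * S * (x\<^sub>1 * \<rho> n)"
      using n by (simp add: mult.assoc x_S_ext S_intertwines x_ext)
    finally show "\<theta> S * S * (x\<^sub>1 * \<rho> n) = \<theta> S * S * (\<rho> (\<rho> n) * x\<^sub>1)" ..
  qed
  have ul: "w\<^sub>1\<^sup>\<dagger> * x\<^sub>1 = 1"
  proof (rule isometry_cancel[OF S_isometry'(1)])
    have "S * (w\<^sub>1\<^sup>\<dagger> * x\<^sub>1) = w\<^sup>\<dagger> * (\<theta> S * (S * x\<^sub>1))"
      using w_adj_intertwines[OF S_mem, THEN mult_ext] by (simp add: w\<^sub>1_def mult.assoc)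
    also have "\<dots> = S"
      by (simp add: x_S unit_left[THEN mult_ext])
    finally show "S * (w\<^sub>1\<^sup>\<dagger> * x\<^sub>1) = S * 1" by simp
  qed
  have ur: "\<rho> (w\<^sub>1\<^sup>\<dagger>) * x\<^sub>1 = 1"
  proof (rule isometry_cancel[OF S_isometry'(1)])
    have "S * (\<rho> (w\<^sub>1\<^sup>\<dagger>) * x\<^sub>1) = \<theta> (w\<^sup>\<dagger>) * (\<theta> S * (S * x\<^sub>1))"
      by (simp add: S_ext theta_ext w\<^sub>1_def)
    also have "\<dots> = S"
      by (simp add: x_S unit_right[THEN mult_ext])
    finally show "S * (\<rho> (w\<^sub>1\<^sup>\<dagger>) * x\<^sub>1) = S * 1" by simp
  qed
  \<comment> \<open>The isometry here is the threefold product of \<open>S\<close>; both sides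
    become the coassociativity of \<open>x\<close> followed by \<open>S\<close>.\<close>
  have as: "x\<^sub>1 * x\<^sub>1 = \<rho> x\<^sub>1 * x\<^sub>1"
  proof (rule isometry_cancel[OF S_isometry'(3)])
    have "\<theta> (\<theta> S) * (\<theta> S * S) * (\<rho> x\<^sub>1 * x\<^sub>1) = \<theta> (\<theta> S * (S * x\<^sub>1)) * (S * x\<^sub>1)"
      by (simp add: mult.assoc S_ext theta_ext)
    also have "\<dots> = \<theta> x * (\<theta> S * (S * x\<^sub>1))"
      by (simp add: x_S hom_mult mult.assoc)
    also have "\<dots> = x * x * S"
      unfolding x_S by (simp add: assoc mult.assoc)
    also have "\<dots> = \<theta> (\<theta> S) * (\<theta> S * S) * (x\<^sub>1 * x\<^sub>1)"
      by (simp add: mult.assoc x_S_ext x_ext x_S)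
    finally show "\<theta> (\<theta> S) * (\<theta> S * S) * (x\<^sub>1 * x\<^sub>1) = \<theta> (\<theta> S) * (\<theta> S * S) * (\<rho> x\<^sub>1 * x\<^sub>1)" ..
  qed
  \<comment> \<open>Both Frobenius relations have the right side
    \<open>x\<^sub>1 * x\<^sub>1\<^sup>\<dagger>\<close>, so it is transported once for the
    two.\<close>
  have T: "\<theta> S * S * (x\<^sub>1 * x\<^sub>1\<^sup>\<dagger>) = x * x\<^sup>\<dagger> * (\<theta> S * S)"
    by (simp add: mult.assoc x_S_ext x_adj_S)
  have fr: "\<rho> (x\<^sub>1\<^sup>\<dagger>) * x\<^sub>1 = x\<^sub>1 * x\<^sub>1\<^sup>\<dagger>"
  proof (rule isometry_cancel[OF S_isometry'(2)])
    have "\<theta> S * S * (\<rho> (x\<^sub>1\<^sup>\<dagger>) * x\<^sub>1) = \<theta> (S * x\<^sub>1\<^sup>\<dagger>) * (S * x\<^sub>1)"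
      by (simp add: mult.assoc S_ext theta_ext)
    also have "\<dots> = \<theta> (x\<^sup>\<dagger>) * (\<theta> (\<theta> S) * (\<theta> S * (S * x\<^sub>1)))"
      unfolding x_adj_S[symmetric] by (simp add: hom_mult mult.assoc)
    also have "\<dots> = x * x\<^sup>\<dagger> * (\<theta> S * S)"
      by (simp add: x_S x_ext frobenius_right[THEN mult_ext] mult.assoc)
    finally show "\<theta> S * S * (\<rho> (x\<^sub>1\<^sup>\<dagger>) * x\<^sub>1) = \<theta> S * S * (x\<^sub>1 * x\<^sub>1\<^sup>\<dagger>)"
      unfolding T .
  qed
  have fl: "x\<^sub>1\<^sup>\<dagger> * \<rho> x\<^sub>1 = x\<^sub>1 * x\<^sub>1\<^sup>\<dagger>"
  proof (rule isometry_cancel[OF S_isometry'(2)])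
    have "\<theta> S * S * (x\<^sub>1\<^sup>\<dagger> * \<rho> x\<^sub>1) = \<theta> S * (x\<^sup>\<dagger> * (\<theta> S * S)) * \<rho> x\<^sub>1"
      unfolding x_adj_S by (simp add: mult.assoc)
    also have "\<dots> = (\<theta> S * x\<^sup>\<dagger>) * (\<theta> S * (S * \<rho> x\<^sub>1))"
      by (simp add: mult.assoc)
    also have "\<dots> = x\<^sup>\<dagger> * (\<theta> (\<theta> S * (S * x\<^sub>1)) * S)"
      by (simp add: S_intertwines x_adj_intertwines[symmetric] mult.assoc theta_ext)
    also have "\<dots> = x * x\<^sup>\<dagger> * (\<theta> S * S)"
      unfolding x_S by (simp add: hom_mult mult.assoc frobenius_left[THEN mult_ext])
    finally show "\<theta> S * S * (x\<^sub>1\<^sup>\<dagger> * \<rho> x\<^sub>1) = \<theta> S * S * (x\<^sub>1 * x\<^sub>1\<^sup>\<dagger>)"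
      unfolding T .
  qed
  show ?thesis
    unfolding frobenius_def Hom_def
    using w1 x1 ul ur as fr fl by auto
qed

end

section \<open>Dimension of the reduced endomorphism\<close>

lemma dim_values_nonneg:
  fixes M :: "'k::complex_hilbert bop set"
  assumes "d \<in> dim_values N M \<alpha>" "(1 :: 'k bop) \<noteq> 0"
  shows "0 \<le> d"
  using assms adj_mult_self_scalar(2)[of _ "complex_of_real d"] by (auto simp: dim_values_def)

context frobenius_endomorphism
begin

text \<open>The scalar \<open>x\<^sup>\<dagger> * x\<close> comes out of the middle, so the two
  values multiply. Applied to the reduced system this bounds its dimension above.\<close>

lemma self_conjugate_dim:
  assumes "w\<^sup>\<dagger> * w = complex_of_real a *\<^sub>B 1" "x\<^sup>\<dagger> * x = complex_of_real b *\<^sub>B 1"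
  shows "a * b \<in> dim_values N N \<theta>"
proof -
  have "(x * w)\<^sup>\<dagger> * (x * w) = complex_of_real (a * b) *\<^sub>B 1"
    by (simp add: mult.assoc assms(2)[THEN mult_ext] assms(1) mult.commute)
  thus ?thesis
    using self_conjugate hom unfolding dim_values_def by blast
qed

end

context frobenius_reduction
begin

lemma P_theta_S: "P * \<theta> S = \<theta> S * P"
  by (simp add: P_commutes)

text \<open>A conjugate \<open>\<theta>'\<close> of the summand \<open>\<rho>\<close> of \<open>\<theta>\<close> is completed to a conjugate of \<open>\<theta>\<close> by the
  complementary summand of \<open>\<theta>\<close>, which is its own conjugate via \<open>R = xw\<close>. Placing it as a corner
  \<open>(1 - P) \<theta>(\<cdot>)\<close> avoids the choice of an isometry with range projection \<open>1 - P\<close>.\<close>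

lemma dim_values_complement:
  assumes d: "d \<in> dim_values N N \<rho>"
    and q: "(x * w)\<^sup>\<dagger> * (1 - P) * (x * w) = complex_of_real q *\<^sub>B 1"
  shows "d + q \<in> dim_values N N \<theta>"
proof -
  obtain \<theta>' t t' where \<theta>': "vn_hom N N \<theta>'" and t: "conjugate_pair N N \<rho> \<theta>' t t'"
    and tt: "t\<^sup>\<dagger> * t = complex_of_real d *\<^sub>B 1" "t'\<^sup>\<dagger> * t' = complex_of_real d *\<^sub>B 1"
    using d by (auto simp: dim_values_def)
  interpret c: vn_endomorphism N \<theta>'
    by unfold_locales (rule \<theta>')
  have t_mem [simp]: "t \<in> N" "t' \<in> N"
    and t_int: "\<And>n. n \<in> N \<Longrightarrow> t * n = \<theta>' (\<rho> n) * t" "\<And>n. n \<in> N \<Longrightarrow> t' * n = \<rho> (\<theta>' n) * t'"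
    and t_conj: "t\<^sup>\<dagger> * \<theta>' t' = 1" "\<rho> (t\<^sup>\<dagger>) * t' = 1"
    using t by (auto simp: conjugate_pair_def Hom_def)
  have t_adj_int: "t\<^sup>\<dagger> * \<theta>' (\<rho> n) = n * t\<^sup>\<dagger>" if "n \<in> N" for n
    using t_int(1)[of "n\<^sup>\<dagger>"] that
    by (metis adj_adj adj_mult adj_mem c.hom_adj rho.hom_adj rho.hom_mem)
  define Q where "Q = 1 - P"
  define R where "R = x * w"
  have Q_mem [simp]: "Q \<in> N" and R_mem [simp]: "R \<in> N"
    by (simp_all add: Q_def R_def)
  have Q_adj [simp]: "Q\<^sup>\<dagger> = Q" and Q_idem: "Q * Q = Q"
    by (simp_all add: Q_def left_diff_distrib right_diff_distrib P_idem)
  have Q_com: "Q * \<theta> n = \<theta> n * Q" if "n \<in> N" for n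
    using that by (simp add: Q_def left_diff_distrib right_diff_distrib P_commutes)
  have QS: "Q * S = 0" and SQ: "S\<^sup>\<dagger> * Q = 0"
    by (simp_all add: Q_def left_diff_distrib right_diff_distrib P_S S_adj_P)
  have SS: "S * S\<^sup>\<dagger> + Q = 1"
    by (simp add: Q_def S_range)
  have R_int: "\<And>n. n \<in> N \<Longrightarrow> R * n = \<theta> (\<theta> n) * R"
    and R_conj: "R\<^sup>\<dagger> * \<theta> R = 1" "\<theta> (R\<^sup>\<dagger>) * R = 1"
    using self_conjugate by (auto simp: conjugate_pair_def Hom_def R_def)
  have R_adj_int: "R\<^sup>\<dagger> * \<theta> (\<theta> n) = n * R\<^sup>\<dagger>" if "n \<in> N" for n
    using R_int[of "n\<^sup>\<dagger>"] that by (metis adj_adj adj_mult adj_mem hom_adj hom_mem)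
  \<comment> \<open>Cutting either leg of \<open>R\<close> by \<open>Q\<close> gives the same
    vector. This is where the relations for \<open>P\<close> enter: they make the complementary
    summand conjugate to itself.\<close>
  have theta_Q_R: "\<theta> Q * R = Q * R"
    by (simp add: Q_def R_def hom_diff left_diff_distrib mult.assoc[symmetric] theta_P_x P_x)
  have R_adj_theta_Q: "R\<^sup>\<dagger> * \<theta> Q = R\<^sup>\<dagger> * Q"
    using arg_cong[OF theta_Q_R, of adj] by (simp flip: hom_adj)
  have theta_0: "\<theta> (S\<^sup>\<dagger>) * \<theta> Q = 0" "\<theta> Q * \<theta> S = 0" and theta_1: "\<theta> (S\<^sup>\<dagger>) * \<theta> S = 1"
    by (simp_all add: SQ QS S_isometry flip: hom_mult)
  have c_1: "\<theta>' (S\<^sup>\<dagger>) * \<theta>' S = 1"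
    by (simp add: S_isometry flip: c.hom_mult)

  define \<theta>\<^sub>c where "\<theta>\<^sub>c n = S * \<theta>' n * S\<^sup>\<dagger> + Q * \<theta> n" for n
  \<comment> \<open>In \<open>W\<close>, \<open>S\<close> embeds \<open>\<theta>'\<close> into
    \<open>\<theta>\<^sub>c\<close> and \<open>\<theta>' S\<close> embeds \<open>\<rho>\<close> into
    \<open>\<theta>\<close>. In \<open>W'\<close>, \<open>S\<close> embeds \<open>\<rho>\<close> and
    \<open>\<theta> S\<close> embeds \<open>\<theta>'\<close>. The part \<open>Q * R\<close> serves
    the complementary block.\<close>
  define W where "W = S * \<theta>' S * t + Q * R"
  define W' where "W' = \<theta> S * S * t' + Q * R"
  have W_mem [simp]: "W \<in> N" "W' \<in> N"
    by (simp_all add: W_def W'_def)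
  have hom_c: "vn_hom N N \<theta>\<^sub>c"
    unfolding vn_hom_on_def
  proof (intro conjI ballI allI)
    fix m n assume m: "m \<in> N" and n: "n \<in> N"
    show "\<theta>\<^sub>c m \<in> N"
      using m by (simp add: \<theta>\<^sub>c_def)
    show "\<theta>\<^sub>c (m + n) = \<theta>\<^sub>c m + \<theta>\<^sub>c n"
      using m n by (simp add: \<theta>\<^sub>c_def hom_add c.hom_add distrib_left distrib_right)
    \<comment> \<open>The mixed terms of the product vanish and the complementary block is
      multiplicative.\<close>
    have "Q * (\<theta> m * (S * y)) = 0" "Q * (\<theta> m * (Q * y)) = Q * (\<theta> m * y)" for y
      using m by (simp_all add: Q_com[THEN mult_ext] QS[THEN mult_ext] mult.assoc)
        (simp add: Q_idem[THEN mult_ext] mult.assoc flip: Q_com)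
    thus "\<theta>\<^sub>c (m * n) = \<theta>\<^sub>c m * \<theta>\<^sub>c n"
      using m n by (simp add: \<theta>\<^sub>c_def hom_mult c.hom_mult distrib_left distrib_right mult.assoc
          S_isometry[THEN mult_ext] SQ[THEN mult_ext])
    show "\<theta>\<^sub>c (c *\<^sub>B m) = c *\<^sub>B \<theta>\<^sub>c m" for c
      using m by (simp add: \<theta>\<^sub>c_def hom_scale c.hom_scale scale_add_right)
    show "\<theta>\<^sub>c (m\<^sup>\<dagger>) = (\<theta>\<^sub>c m)\<^sup>\<dagger>"
      using m by (simp add: \<theta>\<^sub>c_def hom_adj c.hom_adj mult.assoc) (simp add: Q_com flip: hom_adj)
  next
    show "\<theta>\<^sub>c 1 = 1"
      by (simp add: \<theta>\<^sub>c_def SS)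
  qed

  \<comment> \<open>The block components of \<open>W\<close> and \<open>W'\<close>, taken on either
    leg; every relation below splits along them.\<close>
  have QW: "Q * W = Q * R" and SW: "S\<^sup>\<dagger> * W = \<theta>' S * t"
    by (simp_all add: W_def distrib_left mult.assoc[symmetric] QS Q_idem S_isometry SQ)
  have QW': "Q * W' = Q * R"
    by (simp add: W'_def distrib_left mult.assoc Q_com[THEN mult_ext] QS[THEN mult_ext] Q_idem[THEN mult_ext])
  have SW': "S\<^sup>\<dagger> * W' = \<rho> S * t'"
    by (simp add: W'_def distrib_left mult.assoc SQ[THEN mult_ext] S_adj_intertwines[THEN mult_ext]
        S_isometry[THEN mult_ext])
  have theta_QW': "\<theta> Q * W' = Q * R"
    by (simp add: W'_def distrib_left mult.assoc theta_0[THEN mult_ext] Q_com[symmetric, THEN mult_ext])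
      (simp add: mult.assoc theta_Q_R Q_idem[THEN mult_ext])
  have theta_SW': "\<theta> (S\<^sup>\<dagger>) * W' = S * t'"
    by (simp add: W'_def distrib_left mult.assoc theta_1[THEN mult_ext] theta_Q_R[symmetric] theta_0[THEN mult_ext])
  have W_adj: "W\<^sup>\<dagger> = t\<^sup>\<dagger> * \<theta>' (S\<^sup>\<dagger>) * S\<^sup>\<dagger> + R\<^sup>\<dagger> * Q"
    by (simp add: W_def c.hom_adj mult.assoc)
  have W'_adj: "W'\<^sup>\<dagger> = t'\<^sup>\<dagger> * S\<^sup>\<dagger> * \<theta> (S\<^sup>\<dagger>) + R\<^sup>\<dagger> * Q"
    by (simp add: W'_def hom_adj mult.assoc)

  have W_int: "W * n = \<theta>\<^sub>c (\<theta> n) * W" if n: "n \<in> N" for n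
  proof -
    have "\<theta>\<^sub>c (\<theta> n) * W = S * (\<theta>' (\<theta> n) * (S\<^sup>\<dagger> * W)) + \<theta> (\<theta> n) * (Q * W)"
      using n by (simp add: \<theta>\<^sub>c_def distrib_right mult.assoc Q_com[THEN mult_ext])
    also have "\<dots> = S * (\<theta>' (\<theta> n * S) * t) + Q * (\<theta> (\<theta> n) * R)"
      using n unfolding SW QW by (simp add: c.hom_mult mult.assoc Q_com[THEN mult_ext])
    also have "\<dots> = W * n"
      using n by (simp add: W_def distrib_right mult.assoc R_int t_int c.hom_mult flip: S_intertwines)
    finally show ?thesis ..
  qed
  have W'_int: "W' * n = \<theta> (\<theta>\<^sub>c n) * W'" if n: "n \<in> N" for n
  proof -
    have "\<theta> (\<theta>\<^sub>c n) = \<theta> S * \<theta> (\<theta>' n) * \<theta> (S\<^sup>\<dagger>) + \<theta> (\<theta> n) * \<theta> Q"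
      using n by (simp add: \<theta>\<^sub>c_def hom_add hom_mult Q_com)
    hence "\<theta> (\<theta>\<^sub>c n) * W' = \<theta> S * (\<theta> (\<theta>' n) * (\<theta> (S\<^sup>\<dagger>) * W')) + \<theta> (\<theta> n) * (\<theta> Q * W')"
      by (simp add: distrib_right mult.assoc)
    also have "\<dots> = \<theta> S * (S * (\<rho> (\<theta>' n) * t')) + Q * (\<theta> (\<theta> n) * R)"
      using n unfolding theta_SW' theta_QW'
      by (simp add: Q_com[THEN mult_ext] S_intertwines[THEN mult_ext] mult.assoc)
    also have "\<dots> = W' * n"
      using n by (simp add: W'_def distrib_right mult.assoc R_int t_int)
    finally show ?thesis ..
  qed
  have W_conj: "W\<^sup>\<dagger> * \<theta>\<^sub>c W' = 1"
  proof -
    have "W\<^sup>\<dagger> * \<theta>\<^sub>c W' = t\<^sup>\<dagger> * (\<theta>' (S\<^sup>\<dagger> * W') * S\<^sup>\<dagger>) + R\<^sup>\<dagger> * (Q * \<theta> W')"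
      by (simp add: W_adj \<theta>\<^sub>c_def distrib_left distrib_right mult.assoc c.hom_mult
          S_isometry[THEN mult_ext] SQ[THEN mult_ext] QS[THEN mult_ext] Q_idem[THEN mult_ext])
    also have "t\<^sup>\<dagger> * (\<theta>' (S\<^sup>\<dagger> * W') * S\<^sup>\<dagger>) = S * S\<^sup>\<dagger>"
      unfolding SW' by (simp add: c.hom_mult t_adj_int[THEN mult_ext] t_conj[THEN mult_ext] mult.assoc)
    \<comment> \<open>\<open>Q\<close> crosses to the other leg of the adjoint of \<open>R\<close>,
      cuts \<open>W'\<close> down to \<open>Q * R\<close>, and crosses again as
      \<open>\<theta> Q\<close>, so that intertwining can pull it out in front.\<close>
    also have "R\<^sup>\<dagger> * (Q * \<theta> W') = R\<^sup>\<dagger> * \<theta> (\<theta> Q * R)"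
      using arg_cong[OF R_adj_theta_Q, of "\<lambda>z. z * \<theta> W'"]
      by (simp add: mult.assoc theta_Q_R QW' flip: hom_mult)
    also have "\<dots> = Q"
      by (simp add: hom_mult R_adj_int[THEN mult_ext] R_conj mult.assoc)
    finally show ?thesis
      by (simp add: SS)
  qed
  have W'_conj: "\<theta> (W\<^sup>\<dagger>) * W' = 1"
  proof -
    have "\<theta> (W\<^sup>\<dagger>) * W' = \<theta> (t\<^sup>\<dagger> * \<theta>' (S\<^sup>\<dagger>)) * (\<theta> (S\<^sup>\<dagger>) * W') + \<theta> (R\<^sup>\<dagger>) * (\<theta> Q * W')"
      by (simp add: W_adj hom_add hom_mult distrib_right mult.assoc)
    also have "\<theta> (t\<^sup>\<dagger> * \<theta>' (S\<^sup>\<dagger>)) * (\<theta> (S\<^sup>\<dagger>) * W') = S * (\<rho> (t\<^sup>\<dagger> * \<theta>' (S\<^sup>\<dagger>)) * t')"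
      unfolding theta_SW' by (simp add: S_intertwines[THEN mult_ext] mult.assoc)
    also have "\<dots> = S * S\<^sup>\<dagger>"
      by (simp add: rho.hom_mult mult.assoc t_conj[THEN mult_ext] flip: t_int)
    also have "\<theta> (R\<^sup>\<dagger>) * (\<theta> Q * W') = Q"
      unfolding theta_QW' using R_conj
      by (simp add: Q_com[symmetric, THEN mult_ext] mult.assoc)
    finally show ?thesis
      by (simp add: SS)
  qed
  have q': "R\<^sup>\<dagger> * (Q * R) = complex_of_real q *\<^sub>B 1"
    using q by (simp add: R_def Q_def mult.assoc)
  \<comment> \<open>The blocks are orthogonal, so their values \<open>d\<close> and \<open>q\<close>
    add.\<close>
  have "W\<^sup>\<dagger> * W = t\<^sup>\<dagger> * (\<theta>' (S\<^sup>\<dagger>) * (S\<^sup>\<dagger> * W)) + R\<^sup>\<dagger> * (Q * W)"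
    by (simp add: W_adj distrib_right mult.assoc)
  also have "\<dots> = complex_of_real (d + q) *\<^sub>B 1"
    unfolding SW QW q' by (simp add: c_1[THEN mult_ext] tt scale_add_left)
  finally have W_norm: "W\<^sup>\<dagger> * W = complex_of_real (d + q) *\<^sub>B 1" .
  have "W'\<^sup>\<dagger> * W' = t'\<^sup>\<dagger> * (S\<^sup>\<dagger> * (\<theta> (S\<^sup>\<dagger>) * W')) + R\<^sup>\<dagger> * (Q * W')"
    by (simp add: W'_adj distrib_right mult.assoc)
  also have "\<dots> = complex_of_real (d + q) *\<^sub>B 1"
    unfolding theta_SW' QW' q' by (simp add: S_isometry[THEN mult_ext] tt scale_add_left)
  finally have W'_norm: "W'\<^sup>\<dagger> * W' = complex_of_real (d + q) *\<^sub>B 1" .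
  have "conjugate_pair N N \<theta> \<theta>\<^sub>c W W'"
    using W_int W'_int W_conj W'_conj by (simp add: conjugate_pair_def Hom_def)
  with hom_c W_norm W'_norm show ?thesis
    unfolding dim_values_def by blast
qed

lemma w1_norm: "w\<^sub>1\<^sup>\<dagger> * w\<^sub>1 = w\<^sup>\<dagger> * (P * w)"
  by (simp add: w\<^sub>1_def mult.assoc S_range[THEN mult_ext])

text \<open>Composing with the isometry \<open>\<theta> S * S\<close> preserves the norm and turns
  \<open>x\<^sub>1\<close> into \<open>x * S\<close>. So the value of \<open>x\<close> survives the
  reduction, while that of \<open>w\<close> drops.\<close>

lemma x1_norm:
  assumes "x\<^sup>\<dagger> * x = c *\<^sub>B 1"
  shows "x\<^sub>1\<^sup>\<dagger> * x\<^sub>1 = c *\<^sub>B 1"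
proof -
  have "x\<^sub>1\<^sup>\<dagger> * x\<^sub>1 = x\<^sub>1\<^sup>\<dagger> * ((\<theta> S * S)\<^sup>\<dagger> * (\<theta> S * S)) * x\<^sub>1"
    using S_isometry'(2) by (simp only: isometry_def mult_1_right)
  also have "\<dots> = (\<theta> S * (S * x\<^sub>1))\<^sup>\<dagger> * (\<theta> S * (S * x\<^sub>1))"
    by (simp add: mult.assoc)
  also have "\<dots> = c *\<^sub>B 1"
    unfolding x_S by (simp add: mult.assoc assms[THEN mult_ext] S_isometry)
  finally show ?thesis .
qed

sublocale red: frobenius_endomorphism N "red_theta \<theta> S" w\<^sub>1 x\<^sub>1
  by unfold_locales (rule frobenius_reduced)

text \<open>The pair from \<open>x\<^sub>1 * w\<^sub>1\<close> attains \<open>sqrt D * c\<close>. No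
  value \<open>d\<close> lies below: completed to \<open>\<theta>\<close> it gives
  \<open>D \<le> d + sqrt D * (sqrt D - c)\<close>, and the two copies of \<open>D\<close>
  cancel.\<close>

lemma hom_dim_reduced:
  fixes D :: real
  defines "D \<equiv> hom_dim N N \<theta>"
  assumes fin: "dim_values N N \<theta> \<noteq> {}" and N: "factor N" and P0: "P \<noteq> 0"
    and w: "w\<^sup>\<dagger> * w = complex_of_real (sqrt D) *\<^sub>B 1"
    and x: "x\<^sup>\<dagger> * x = complex_of_real (sqrt D) *\<^sub>B 1"
  obtains c where "0 < c" "0 < D" "w\<^sub>1\<^sup>\<dagger> * w\<^sub>1 = complex_of_real c *\<^sub>B 1"
    "hom_dim N N \<rho> = sqrt D * c" "dim_values N N \<rho> \<noteq> {}"
proof -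
  have ne: "(1 :: 'a bop) \<noteq> 0"
    using N by (simp add: factor_def)
  have D_le: "D \<le> d" if "d \<in> dim_values N N \<theta>" for d
    unfolding D_def hom_dim_def
    by (rule cInf_lower[OF that]) (rule bdd_belowI[of _ 0], rule dim_values_nonneg[OF _ ne])
  have D0: "0 \<le> D"
    unfolding D_def hom_dim_def
    by (rule cInf_greatest[OF fin]) (rule dim_values_nonneg[OF _ ne])
  have "x \<noteq> 0"
    using unit_left ne by auto
  hence "D \<noteq> 0"
    using x adj_mult_self_eq_0[of x] by auto
  with D0 have D: "0 < D" by simp
  \<comment> \<open>A self-intertwiner of the identity lies in the center of the factor, hence is a
    scalar.\<close>
  have "w\<^sup>\<dagger> * (P * w) * n = n * (w\<^sup>\<dagger> * (P * w))" if "n \<in> N" for n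
    using that w_intertwines[OF that] P_commutes[OF that, THEN mult_ext, of w]
      w_adj_intertwines[OF that, THEN mult_ext, of "P * w"]
    by (simp add: mult.assoc)
  hence "w\<^sub>1\<^sup>\<dagger> * w\<^sub>1 \<in> N \<inter> commutant N"
    by (simp add: commutant_iff w1_norm)
  hence "w\<^sub>1\<^sup>\<dagger> * w\<^sub>1 \<in> {c *\<^sub>B 1 | c. True}"
    using N unfolding factor_def by metis
  then obtain z where z: "w\<^sub>1\<^sup>\<dagger> * w\<^sub>1 = z *\<^sub>B 1"
    by blast
  define c where "c = Re z"
  have zc: "z = complex_of_real c" and c0: "0 \<le> c"
    using adj_mult_self_scalar[OF z ne] by (auto simp: c_def complex_eq_iff)
  \<comment> \<open>Otherwise \<open>w\<^sup>\<dagger> * P = 0\<close>; moving \<open>P\<close>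
    through \<open>x\<close> and using \<open>w\<^sup>\<dagger> * x = 1\<close> would give
    \<open>P = 0\<close>.\<close>
  have "c \<noteq> 0"
  proof
    assume "c = 0"
    hence "S\<^sup>\<dagger> * w = 0"
      using adj_mult_self_eq_0[of w\<^sub>1] z zc by (simp add: w\<^sub>1_def)
    hence "(P * w)\<^sup>\<dagger> = 0\<^sup>\<dagger>"
      by (simp add: S_range[symmetric] mult.assoc)
    hence "w\<^sup>\<dagger> * P = 0"
      using adj_scale[of 0 0] by simp
    hence "w\<^sup>\<dagger> * x * P = 0"
      by (metis P_x mult.assoc mult_zero_left)
    with P0 show False
      by (simp add: unit_left)
  qed
  with c0 have c: "0 < c" by simp
  have w1: "w\<^sub>1\<^sup>\<dagger> * w\<^sub>1 = complex_of_real c *\<^sub>B 1"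
    using z zc by simp
  have mem: "sqrt D * c \<in> dim_values N N \<rho>"
    using red.self_conjugate_dim[OF w1 x1_norm[OF x]] by (simp add: mult.commute)
  have least: "sqrt D * c \<le> d" if d: "d \<in> dim_values N N \<rho>" for d
  proof -
    have "(x * w)\<^sup>\<dagger> * (1 - P) * (x * w) = w\<^sup>\<dagger> * (x\<^sup>\<dagger> * x) * (w - P * w)"
      using P_x by (simp add: left_diff_distrib right_diff_distrib mult.assoc) (metis mult.assoc)
    also have "\<dots> = complex_of_real (sqrt D) *\<^sub>B (w\<^sup>\<dagger> * w - w\<^sup>\<dagger> * (P * w))"
      unfolding x by (simp add: right_diff_distrib scale_diff_right)
    also have "\<dots> = complex_of_real (sqrt D * (sqrt D - c)) *\<^sub>B 1"
      unfolding w w1_norm[symmetric] w1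
      using scale_add_left[of "complex_of_real (sqrt D - c)" "complex_of_real c" "1 :: 'a bop"] by simp
    finally have "D \<le> d + sqrt D * (sqrt D - c)"
      by (intro D_le dim_values_complement[OF d])
    moreover have "sqrt D * sqrt D = D"
      using D0 by simp
    ultimately show ?thesis
      by (simp add: right_diff_distrib)
  qed
  have "hom_dim N N \<rho> = sqrt D * c"
    unfolding hom_dim_def using mem least by (rule cInf_eq_minimum)
  with c D w1 mem show thesis
    using that by blast
qed

end

section \<open>The reduced extension\<close>

text \<open>For \<open>X\<close> in the double commutant of the corner and \<open>T\<close> in the
  commutant of \<open>M\<close>, the compression \<open>e * T * e\<close> commutes with the corner,
  hence with \<open>X\<close>. As \<open>T\<close> commutes with \<open>e\<close> and
  \<open>X = e * X * e\<close>, also \<open>T\<close> commutes with \<open>X\<close>, so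
  \<open>X\<close> lies in \<open>M\<close>.\<close>

lemma von_neumann_algebra_central_corner:
  assumes M: "von_neumann_algebra M" and e: "projection e" "e \<in> M" "e \<in> commutant M"
  shows "von_neumann_algebra_on e ((\<lambda>m. e * m) ` M)"
proof -
  interpret vn_algebra M by unfold_locales fact
  have ee: "e * e = e" and ea: "e\<^sup>\<dagger> = e"
    using e(1) by (auto simp: projection_def)
  have em: "e * m = m * e" if "m \<in> M" for m
    using e(3) that by (simp add: commutant_iff)
  have eme: "e * (m * e) = e * m" if "m \<in> M" for m
    using em[OF that] ee by (metis mult.assoc)
  have "X \<in> (\<lambda>m. e * m) ` M" if X: "X \<in> commutant_on e (commutant_on e ((\<lambda>m. e * m) ` M))" for X
  proof -
    have eXe: "e * X * e = X"
      using X by (simp add: commutant_on_def)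
    hence eX: "e * X = X" and Xe: "X * e = X"
      using ee by (metis mult.assoc)+
    have "X * T = T * X" if T: "T \<in> commutant M" for T
    proof -
      have Tm: "T * m = m * T" if "m \<in> M" for m
        using T that by (simp add: commutant_iff)
      have "e * T * e \<in> commutant_on e ((\<lambda>m. e * m) ` M)"
      proof -
        have "e * T * e * (e * m) = e * m * (e * T * e)" if "m \<in> M" for m
          using Tm[OF that] Tm[OF e(2)] em[OF that] ee by (metis mult.assoc)
        thus ?thesis
          using ee by (auto simp: commutant_on_def mult.assoc) (metis mult.assoc)+
      qed
      hence "X * (e * T * e) = e * T * e * X"
        using X by (simp add: commutant_on_def)
      thus ?thesis
        using Tm[OF e(2)] eX Xe ee by (metis mult.assoc)
    qed
    hence "X \<in> M"
      by (rule memI)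
    thus ?thesis
      using eX by force
  qed
  moreover have "e * m \<in> commutant_on e (commutant_on e ((\<lambda>m. e * m) ` M))" if "m \<in> M" for m
    using that ee eme[OF that] by (auto simp: commutant_on_def mult.assoc) (metis mult.assoc)+
  moreover have "(e * m)\<^sup>\<dagger> \<in> (\<lambda>m. e * m) ` M" if "m \<in> M" for m
    using that em[of "m\<^sup>\<dagger>"] by (metis adj_mem adj_mult ea imageI)
  ultimately show ?thesis
    using e(1) eme ee by (auto simp: von_neumann_algebra_on_def mult.assoc) (metis mult.assoc)+
qed

section \<open>Coordinates on the extension and the central projection\<close>

locale frobenius_extension = frobenius_reduction N \<theta> w x P S + \<iota>: vn_homomorphism N 1 M \<iota>
  for N :: "'h::complex_hilbert bop set" and \<theta> w x P S
    and M :: "'k::complex_hilbert bop set" and \<iota> +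
  fixes v
  assumes ext: "extension N \<theta> w x M \<iota> v"
begin

sublocale M: vn_algebra M
  using ext by unfold_locales (simp add: extension_on_def)

lemma v_mem [simp]: "v \<in> M"
  and v_intertwines: "n \<in> N \<Longrightarrow> v * \<iota> n = \<iota> (\<theta> n) * v"
  and v_v: "v * v = \<iota> x * v"
  and v_adj: "v\<^sup>\<dagger> = \<iota> (w\<^sup>\<dagger> * x\<^sup>\<dagger>) * v"
  and coordinates: "bij_betw (\<lambda>n. \<iota> n * v) N M"
  using ext by (auto simp: extension_on_def)

text \<open>The coordinate bijection from \<open>N\<close> to \<open>M\<close>, through which
  products and adjoints in \<open>M\<close> become formulas in \<open>\<theta>\<close>,
  \<open>w\<close> and \<open>x\<close>.\<close>

definition "E n = \<iota> n * v"

lemma E_mem [simp]: "n \<in> N \<Longrightarrow> E n \<in> M"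
  by (simp add: E_def)

lemma E_cases:
  assumes "m \<in> M"
  obtains n where "n \<in> N" "m = E n"
  using assms coordinates by (auto simp: bij_betw_def E_def)

lemma E_inj: "m \<in> N \<Longrightarrow> n \<in> N \<Longrightarrow> E m = E n \<longleftrightarrow> m = n"
  using coordinates by (auto simp: bij_betw_def E_def inj_on_def)

lemma iota_E: "m \<in> N \<Longrightarrow> n \<in> N \<Longrightarrow> \<iota> m * E n = E (m * n)"
  by (simp add: E_def \<iota>.hom_mult mult.assoc)

lemma E_iota: "m \<in> N \<Longrightarrow> n \<in> N \<Longrightarrow> E m * \<iota> n = E (m * \<theta> n)"
  by (simp add: E_def \<iota>.hom_mult mult.assoc v_intertwines)

lemma E_E: "m \<in> N \<Longrightarrow> n \<in> N \<Longrightarrow> E m * E n = E (m * \<theta> n * x)"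
  by (simp add: E_def \<iota>.hom_mult mult.assoc v_intertwines[THEN mult_ext] v_v)

lemma E_scale: "n \<in> N \<Longrightarrow> E (c *\<^sub>B n) = c *\<^sub>B E n"
  by (simp add: E_def \<iota>.hom_scale)

lemma E_adj: "n \<in> N \<Longrightarrow> (E n)\<^sup>\<dagger> = E (w\<^sup>\<dagger> * x\<^sup>\<dagger> * \<theta> (n\<^sup>\<dagger>))"
  using E_iota[of "w\<^sup>\<dagger> * x\<^sup>\<dagger>" "n\<^sup>\<dagger>"] by (simp add: E_def v_adj \<iota>.hom_adj)

text \<open>The coordinate is found by solving \<open>\<theta> n * x = P\<close>: multiplying by
  \<open>w\<^sup>\<dagger>\<close> on the left leaves
  \<open>n = w\<^sup>\<dagger> * P\<close>.\<close>

definition "e = E (w\<^sup>\<dagger> * P)"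

lemma e_mem [simp]: "e \<in> M"
  by (simp add: e_def)

lemma theta_e: "\<theta> (w\<^sup>\<dagger> * P) * x = P"
  by (simp add: hom_mult mult.assoc theta_P_x unit_right[THEN mult_ext])

lemma E_e: "n \<in> N \<Longrightarrow> E n * e = E (n * P)"
  by (simp add: e_def E_E mult.assoc theta_e)

text \<open>Uses the relation \<open>P_x\<close>, whereas \<open>E_e\<close> rests on
  \<open>theta_P_x\<close>. The agreement of the two formulas is the centrality of
  \<open>e\<close>.\<close>

lemma e_E: "n \<in> N \<Longrightarrow> e * E n = E (n * P)"
  by (simp add: e_def E_E mult.assoc P_commutes[THEN mult_ext] w_adj_intertwines[THEN mult_ext]
      P_x unit_left[THEN mult_ext])

lemma e_idem: "e * e = e"
  using e_E[of "w\<^sup>\<dagger> * P"] by (simp add: mult.assoc P_idem flip: e_def)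

lemma x_adj_theta_P: "x\<^sup>\<dagger> * \<theta> P = P * x\<^sup>\<dagger>"
  using arg_cong[OF theta_P_x, of adj] by (simp flip: hom_adj)

lemma x_adj_P: "x\<^sup>\<dagger> * P = P * x\<^sup>\<dagger>"
  using arg_cong[OF P_x, of adj] by simp

lemma projection_e: "projection e"
proof -
  have "e\<^sup>\<dagger> = e"
    unfolding e_def
    by (simp add: E_adj hom_mult mult.assoc x_adj_theta_P[THEN mult_ext] unit_right_adj)
  thus ?thesis
    by (simp add: projection_def e_idem)
qed

lemma e_commutant: "e \<in> commutant M"
  by (auto simp: commutant_iff e_E E_e elim!: E_cases)

text \<open>Left multiplication by \<open>w\<^sup>\<dagger>\<close> recovers the coordinate
  \<open>n\<close> from \<open>\<theta> n * x\<close>.\<close>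

lemma extension_conjugate_eq_P_iff:
  assumes "extension_conjugate N \<theta> x \<iota> v \<iota>'" "m \<in> M"
  shows "\<iota>' m = P \<longleftrightarrow> m = e"
proof -
  obtain n where n: "n \<in> N" "m = E n"
    using assms(2) by (rule E_cases)
  have "\<iota>' m = \<theta> n * x"
    using assms(1) n by (simp add: extension_conjugate_def E_def)
  moreover have "n = w\<^sup>\<dagger> * P" if "\<theta> n * x = P"
    using arg_cong[OF that, of "(*) (w\<^sup>\<dagger>)"] n
    by (simp add: w_adj_intertwines[THEN mult_ext] mult.assoc unit_left)
  ultimately show ?thesis
    using n E_inj theta_e by (auto simp: e_def)
qed

text \<open>The new generator is \<open>E (S\<^sup>\<dagger>)\<close>, rescaled inversely to
  \<open>w\<^sub>1\<close>. The corner consists of all \<open>E (n * P)\<close>, and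
  \<open>P = S * S\<^sup>\<dagger>\<close> translates these into coordinates over the new
  generator.\<close>

lemma extension_reduced:
  fixes r :: real
  assumes r: "r \<noteq> 0"
  shows "extension_on N \<rho> (complex_of_real r *\<^sub>B w\<^sub>1) (complex_of_real (inverse r) *\<^sub>B x\<^sub>1)
    e ((\<lambda>m. e * m) ` M) (\<lambda>n. e * \<iota> n) (complex_of_real (inverse r) *\<^sub>B E (S\<^sup>\<dagger>))"
proof -
  let ?k = "complex_of_real (inverse r)"
  have rk: "complex_of_real r * ?k = 1"
    using r by (simp flip: of_real_mult)
  have e_com: "m * e = e * m" if "m \<in> M" for m
    using e_commutant that by (simp add: commutant_iff)
  have e_iota_E: "e * (\<iota> m * E n) = E (m * n * P)" if "m \<in> N" "n \<in> N" for m n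
    using that by (simp add: iota_E e_E)
  have E_S_e: "E (S\<^sup>\<dagger>) * e = E (S\<^sup>\<dagger>)"
    by (simp add: E_e S_adj_P)
  have hom_e: "vn_hom_on N e ((\<lambda>m. e * m) ` M) (\<lambda>n. e * \<iota> n)"
  proof -
    have "e * \<iota> m * (e * \<iota> n) = e * (\<iota> m * \<iota> n)" if "m \<in> N" for m n
      using e_com[of "\<iota> m"] that e_idem by (metis \<iota>.hom_mem mult.assoc)
    moreover have "e * (\<iota> n)\<^sup>\<dagger> = (e * \<iota> n)\<^sup>\<dagger>" if "n \<in> N" for n
      using e_com[of "(\<iota> n)\<^sup>\<dagger>"] that projection_e by (simp add: projection_def)
    ultimately show ?thesis
      by (auto simp: vn_hom_on_def \<iota>.hom_add \<iota>.hom_mult \<iota>.hom_scale \<iota>.hom_adj distrib_left)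
  qed
  have coord: "e * \<iota> n * (?k *\<^sub>B E (S\<^sup>\<dagger>)) = E (?k *\<^sub>B (n * S\<^sup>\<dagger>))" if "n \<in> N" for n
    using that by (simp add: e_iota_E E_scale mult.assoc S_adj_P)
  have bij: "bij_betw (\<lambda>n. e * \<iota> n * (?k *\<^sub>B E (S\<^sup>\<dagger>))) N ((\<lambda>m. e * m) ` M)"
    unfolding bij_betw_def
  proof (intro conjI inj_onI subset_antisym subsetI)
    fix m n assume m: "m \<in> N" and n: "n \<in> N"
      and eq: "e * \<iota> m * (?k *\<^sub>B E (S\<^sup>\<dagger>)) = e * \<iota> n * (?k *\<^sub>B E (S\<^sup>\<dagger>))"
    have "?k *\<^sub>B (m * S\<^sup>\<dagger>) = ?k *\<^sub>B (n * S\<^sup>\<dagger>)"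
      using eq m n by (simp only: coord E_inj scale_mem mult_mem adj_mem S_mem)
    hence "(complex_of_real r *\<^sub>B (?k *\<^sub>B (m * S\<^sup>\<dagger>))) * S = (complex_of_real r *\<^sub>B (?k *\<^sub>B (n * S\<^sup>\<dagger>))) * S"
      by simp
    thus "m = n"
      by (simp add: rk mult.assoc S_isometry del: of_real_inverse)
  next
    fix y assume "y \<in> (\<lambda>n. e * \<iota> n * (?k *\<^sub>B E (S\<^sup>\<dagger>))) ` N"
    then obtain n where n: "n \<in> N" "y = e * (\<iota> n * (?k *\<^sub>B E (S\<^sup>\<dagger>)))"
      by (auto simp: mult.assoc)
    moreover have "\<iota> n * (?k *\<^sub>B E (S\<^sup>\<dagger>)) \<in> M"
      using n by simp
    ultimately show "y \<in> (\<lambda>m. e * m) ` M"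
      by blast
  next
    fix y assume "y \<in> (\<lambda>m. e * m) ` M"
    then obtain n where n: "n \<in> N" "y = e * E n"
      by (auto elim!: E_cases)
    \<comment> \<open>From \<open>n * P = (n * S) * S\<^sup>\<dagger>\<close>; the factor
      \<open>r\<close> undoes the scale of the generator.\<close>
    have "y = e * \<iota> (complex_of_real r *\<^sub>B (n * S)) * (?k *\<^sub>B E (S\<^sup>\<dagger>))"
      using n rk by (subst coord) (simp_all add: e_E mult.assoc S_range mult.commute del: of_real_inverse)
    moreover have "complex_of_real r *\<^sub>B (n * S) \<in> N"
      using n by simp
    ultimately show "y \<in> (\<lambda>n. e * \<iota> n * (?k *\<^sub>B E (S\<^sup>\<dagger>))) ` N"
      by blast
  qed
  have "e * (?k *\<^sub>B E (S\<^sup>\<dagger>)) = ?k *\<^sub>B E (S\<^sup>\<dagger>)"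
    by (simp add: e_E S_adj_P)
  hence mem: "?k *\<^sub>B E (S\<^sup>\<dagger>) \<in> (\<lambda>m. e * m) ` M"
    by (intro image_eqI[of _ _ "?k *\<^sub>B E (S\<^sup>\<dagger>)"]) simp_all
  have int: "?k *\<^sub>B E (S\<^sup>\<dagger>) * (e * \<iota> n) = e * \<iota> (\<rho> n) * ?k *\<^sub>B E (S\<^sup>\<dagger>)" if "n \<in> N" for n
    using that E_S_e[THEN mult_ext, of "\<iota> n"]
    by (simp add: E_iota S_adj_intertwines mult.assoc e_iota_E S_adj_P)
  have sq: "?k *\<^sub>B E (S\<^sup>\<dagger>) * ?k *\<^sub>B E (S\<^sup>\<dagger>) = e * \<iota> (?k *\<^sub>B x\<^sub>1) * ?k *\<^sub>B E (S\<^sup>\<dagger>)"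
    by (simp add: e_iota_E E_E \<iota>.hom_scale mult.assoc S_adj_x S_adj_P)
  \<comment> \<open>Equates the coordinates of the two sides of the adjoint relation. To the right
    of \<open>x\<^sup>\<dagger>\<close>, \<open>P\<close> may be replaced by
    \<open>\<theta> P\<close>, which \<open>\<theta> S\<close> absorbs.\<close>
  have w1x1: "w\<^sub>1\<^sup>\<dagger> * (x\<^sub>1\<^sup>\<dagger> * S\<^sup>\<dagger>) = w\<^sup>\<dagger> * (x\<^sup>\<dagger> * \<theta> S)"
  proof -
    have "w\<^sub>1\<^sup>\<dagger> * (x\<^sub>1\<^sup>\<dagger> * S\<^sup>\<dagger>) = w\<^sup>\<dagger> * ((S * x\<^sub>1\<^sup>\<dagger>) * S\<^sup>\<dagger>)"
      by (simp add: w\<^sub>1_def mult.assoc)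
    also have "\<dots> = w\<^sup>\<dagger> * (x\<^sup>\<dagger> * (P * \<theta> S))"
      unfolding x_adj_S[symmetric] by (simp add: mult.assoc S_range P_theta_S)
    also have "x\<^sup>\<dagger> * (P * \<theta> S) = x\<^sup>\<dagger> * (\<theta> P * \<theta> S)"
      by (simp add: x_adj_theta_P[THEN mult_ext] x_adj_P[THEN mult_ext] mult.assoc)
    also have "\<theta> P * \<theta> S = \<theta> S"
      by (simp add: P_S flip: hom_mult)
    finally show ?thesis .
  qed
  have adj: "(?k *\<^sub>B E (S\<^sup>\<dagger>))\<^sup>\<dagger> =
      e * \<iota> ((complex_of_real r *\<^sub>B w\<^sub>1)\<^sup>\<dagger> * (?k *\<^sub>B x\<^sub>1)\<^sup>\<dagger>) * ?k *\<^sub>B E (S\<^sup>\<dagger>)"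
    using r by (simp add: E_adj \<iota>.hom_scale e_iota_E mult.assoc S_adj_P) (simp add: w1x1)
  have unit: "e = e * \<iota> ((complex_of_real r *\<^sub>B w\<^sub>1)\<^sup>\<dagger>) * ?k *\<^sub>B E (S\<^sup>\<dagger>)"
    using r by (simp add: \<iota>.hom_scale e_iota_E mult.assoc S_adj_P) (simp add: w\<^sub>1_def S_range mult.assoc e_def)
  show ?thesis
    unfolding extension_on_def
    using von_neumann_algebra_central_corner[OF M.vna projection_e e_mem e_commutant]
      hom_e bij mem int sq adj unit by blast
qed

end

section \<open>Normalization and assembly of the reduced Q-system\<close>

theorem proposition4p3:
  fixes N :: "'h::complex_hilbert bop set"
    and C :: "('h bop \<Rightarrow> 'h bop) set"
    and \<theta> :: "'h bop \<Rightarrow> 'h bop"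
    and w x P S :: "'h bop"
    and M :: "'k::complex_hilbert bop set"
    and \<iota> :: "'h bop \<Rightarrow> 'k bop"
    and \<iota>' :: "'k bop \<Rightarrow> 'h bop"
    and v :: "'k bop"
  assumes separable: "separable_space (euclidean :: 'h topology)"
    and N: "type_III_factor N"
    and C: "full_tensor_subcategory N C"
    and A: "Q_system N C \<theta> w x"
    and M: "extension N \<theta> w x M \<iota> v"
    and conj: "extension_conjugate N \<theta> x \<iota> v \<iota>'"
    and P: "P \<in> Hom N N \<theta> \<theta>" "projection P" "P \<noteq> 0"
    and Px: "(1 \<otimes>\<^bsub>\<theta>\<^esub> P) * x = x * P" "x * P = (P \<otimes>\<^bsub>\<theta>\<^esub> 1) * x"
    and S: "S \<in> N" "isometry S" "S * S\<^sup>\<dagger> = P"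
  shows "(P \<otimes>\<^bsub>\<theta>\<^esub> P) * x = (P \<otimes>\<^bsub>\<theta>\<^esub> 1) * x * P
       \<and> (P \<otimes>\<^bsub>\<theta>\<^esub> 1) * x * P = (1 \<otimes>\<^bsub>\<theta>\<^esub> P) * x * P
       \<and> red_n \<theta> x P S = complex_of_real (sqrt (hom_dim N N \<theta>)) *\<^sub>B 1
       \<and> Q_system N C (red_theta \<theta> S) (red_w N \<theta> w x P S) (red_x N \<theta> x P S)
       \<and> (\<exists>!e. e \<in> M \<and> \<iota>' e = P)
       \<and> (\<forall>e\<in>M. \<iota>' e = P \<longrightarrow>
            projection e \<and> e \<in> commutant M \<and>
            (\<exists>vP. extension_on N (red_theta \<theta> S) (red_w N \<theta> w x P S) (red_x N \<theta> x P S)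
                     e ((\<lambda>m. e * m) ` M) (\<lambda>n. e * \<iota> n) vP))
       \<and> (1 \<otimes>\<^bsub>\<theta>\<^esub> (1 - P)) * x = x * (1 - P)
       \<and> x * (1 - P) = ((1 - P) \<otimes>\<^bsub>\<theta>\<^esub> 1) * x"
proof -
  have fac: "factor N" and vN: "von_neumann_algebra N"
    using N unfolding type_III_factor_def factor_def by blast+
  have \<theta>C: "\<theta> \<in> C" and "\<theta> \<in> End0 N"
    using A C unfolding Q_system_def full_tensor_subcategory_def by blast+
  hence hom: "vn_hom N N \<theta>" and fin: "dim_values N N \<theta> \<noteq> {}"
    by (auto simp: End0_def)
  have one: "\<theta> 1 = 1"
    using hom by (simp add: vn_hom_on_def)
  have frob: "frobenius N \<theta> w x"
    and norms: "w\<^sup>\<dagger> * w = complex_of_real (sqrt (hom_dim N N \<theta>)) *\<^sub>B 1"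
      "x\<^sup>\<dagger> * x = complex_of_real (sqrt (hom_dim N N \<theta>)) *\<^sub>B 1"
    using A Q_system_iff_frobenius[where \<theta> = \<theta>, OF one] by blast+
  have Px': "\<theta> P * x = x * P" "P * x = x * P"
    using Px by (simp_all add: hprod_def one)
  interpret frobenius_extension N \<theta> w x P S M \<iota> v
  proof unfold_locales
    show "vn_hom_on N 1 M \<iota>"
      using M unfolding extension_on_def by blast
    show "P \<in> N" and "\<And>n. n \<in> N \<Longrightarrow> P * \<theta> n = \<theta> n * P"
      using P(1) by (simp_all add: Hom_def)
    show "S\<^sup>\<dagger> * S = 1"
      using S(2) by (simp add: isometry_def)
  qed (rule vN hom frob P(2) Px' S(1,3) M)+
  obtain c where c: "0 < c" and D: "0 < hom_dim N N \<theta>"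
    and w1: "w\<^sub>1\<^sup>\<dagger> * w\<^sub>1 = complex_of_real c *\<^sub>B 1"
    and dim: "hom_dim N N \<rho> = sqrt (hom_dim N N \<theta>) * c" and fin': "dim_values N N \<rho> \<noteq> {}"
    using hom_dim_reduced[OF fin fac P(3) norms] by blast
  define s where "s = sqrt (hom_dim N N \<theta>)"
  define \<delta> where "\<delta> = hom_dim N N \<rho>"
  \<comment> \<open>The total scalar in \<open>red_w\<close>, as \<open>red_n\<close> is
    \<open>s\<close> times the identity. In \<open>red_x\<close> two inverse roots and one root of
    \<open>s\<close> leave \<open>inverse (sqrt s)\<close>, so its scalar is
    \<open>inverse r\<close>.\<close>
  define r where "r = \<delta> powr (-1/4) * sqrt s"
  have s: "0 < s" and \<delta>: "\<delta> = s * c" "0 < \<delta>"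
    using c D by (simp_all add: s_def \<delta>_def dim)
  have r: "r \<noteq> 0" and inv_r: "inverse r = \<delta> powr (1/4) * inverse (sqrt s)"
    using s \<delta>(2) by (simp_all add: r_def powr_minus)
  have powr_quarter: "\<delta> powr (1/4) * \<delta> powr (1/4) = sqrt \<delta>"
    using \<delta>(2) powr_half_sqrt[of \<delta>] powr_add[of \<delta> "1/4" "1/4"] by simp
  \<comment> \<open>The dimension formula \<open>\<delta> = s * c\<close> is decisive here:
    \<open>r * r\<close> is \<open>s\<close> divided by \<open>sqrt \<delta>\<close>.\<close>
  have norm_w: "r * r * c = sqrt \<delta>"
  proof -
    have "r * r * c = (\<delta> powr (-1/4) * \<delta> powr (-1/4)) * (sqrt s * sqrt s * c)"
      unfolding r_def by (simp only: mult_ac)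
    also have "sqrt s * sqrt s * c = \<delta>"
      using s \<delta>(1) by simp
    also have "(\<delta> powr (-1/4) * \<delta> powr (-1/4)) * \<delta> = inverse (sqrt \<delta>) * \<delta>"
      unfolding powr_quarter[symmetric] by (simp add: powr_minus)
    also have "\<dots> = sqrt \<delta>"
      using \<delta>(2) by (simp add: field_simps)
    finally show ?thesis .
  qed
  have norm_x: "inverse r * inverse r * s = sqrt \<delta>"
    unfolding inv_r powr_quarter[symmetric] using s by (simp add: field_simps)

  \<comment> \<open>Both copies of \<open>P\<close> pass through \<open>x\<close> and are absorbed
    by \<open>S\<close>, leaving the scalar \<open>x\<^sup>\<dagger> * x\<close>.\<close>
  have n: "red_n \<theta> x P S = complex_of_real s *\<^sub>B 1"
  proof -
    have "red_n \<theta> x P S = S\<^sup>\<dagger> * (x\<^sup>\<dagger> * x * (P * S))"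
      by (simp add: red_n_def hprod_def mult.assoc Px'[THEN mult_ext])
        (simp add: mult.assoc P_S P_x[THEN mult_ext])
    also have "\<dots> = complex_of_real s *\<^sub>B 1"
      by (simp add: norms s_def P_S S_isometry)
    finally show ?thesis .
  qed
  have root: "sqrt_bop (red_n \<theta> x P S) = complex_of_real (sqrt s) *\<^sub>B 1"
    unfolding n by (rule sqrt_bop_scalar[OF s])
  have inv_root: "inverse_bop (complex_of_real (sqrt s) *\<^sub>B 1) = complex_of_real (inverse (sqrt s)) *\<^sub>B (1 :: 'h bop)"
    using s inverse_bop_scalar[of "complex_of_real (sqrt s)"] by simp
  have red_w: "red_w N \<theta> w x P S = complex_of_real r *\<^sub>B w\<^sub>1"
    by (simp add: red_w_def root w\<^sub>1_def r_def \<delta>_def)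
  have red_x: "red_x N \<theta> x P S = complex_of_real (inverse r) *\<^sub>B x\<^sub>1"
  proof -
    have "red_x N \<theta> x P S = complex_of_real
        (\<delta> powr (1/4) * (inverse (sqrt s) * (inverse (sqrt s) * sqrt s))) *\<^sub>B x\<^sub>1"
      unfolding red_x_def Let_def root inv_root
      by (simp add: hprod_def hom_scale x\<^sub>1_def mult.assoc \<delta>_def mult.commute mult.left_commute)
    thus ?thesis
      using s by (simp add: inv_r)
  qed
  have frob': "frobenius N \<rho> (red_w N \<theta> w x P S) (red_x N \<theta> x P S)"
    unfolding red_w red_x by (rule red.frobenius_rescale[OF r])
  have "\<rho> \<in> End0 N"
    using rho.hom fin' by (simp add: End0_def)
  moreover have "S \<in> Hom N N \<rho> \<theta>"
    by (simp add: Hom_def S_intertwines)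
  ultimately have \<rho>C: "\<rho> \<in> C"
    using C \<theta>C S(2) unfolding full_tensor_subcategory_def by blast
  have "(red_w N \<theta> w x P S)\<^sup>\<dagger> * red_w N \<theta> w x P S = complex_of_real (sqrt \<delta>) *\<^sub>B 1"
    unfolding red_w norm_w[symmetric] by (simp add: w1 mult.assoc)
  moreover have "(red_x N \<theta> x P S)\<^sup>\<dagger> * red_x N \<theta> x P S = complex_of_real (sqrt \<delta>) *\<^sub>B 1"
    unfolding red_x norm_x[symmetric] by (simp add: x1_norm[OF norms(2)] s_def mult.assoc)
  ultimately have Q: "Q_system N C \<rho> (red_w N \<theta> w x P S) (red_x N \<theta> x P S)"
    using \<rho>C frob' by (simp add: Q_system_iff_frobenius \<delta>_def)
  note iff = extension_conjugate_eq_P_iff[OF conj]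
  have unique: "\<exists>!e. e \<in> M \<and> \<iota>' e = P"
    using iff e_mem by blast
  have ext_e: "\<exists>vP. extension_on N \<rho> (red_w N \<theta> w x P S) (red_x N \<theta> x P S)
      e ((\<lambda>m. e * m) ` M) (\<lambda>n. e * \<iota> n) vP"
    unfolding red_w red_x using extension_reduced[OF r] by blast
  have "\<forall>f\<in>M. \<iota>' f = P \<longrightarrow> projection f \<and> f \<in> commutant M \<and>
      (\<exists>vP. extension_on N \<rho> (red_w N \<theta> w x P S) (red_x N \<theta> x P S)
        f ((\<lambda>m. f * m) ` M) (\<lambda>n. f * \<iota> n) vP)"
    using iff projection_e e_commutant ext_e by simp
  moreover have "(P \<otimes>\<^bsub>\<theta>\<^esub> P) * x = (P \<otimes>\<^bsub>\<theta>\<^esub> 1) * x * P" "(P \<otimes>\<^bsub>\<theta>\<^esub> 1) * x * P = (1 \<otimes>\<^bsub>\<theta>\<^esub> P) * x * P"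
    using Px' by (simp_all add: hprod_def mult.assoc) (metis P_idem mult.assoc)
  moreover have "(1 \<otimes>\<^bsub>\<theta>\<^esub> (1 - P)) * x = x * (1 - P)" "x * (1 - P) = ((1 - P) \<otimes>\<^bsub>\<theta>\<^esub> 1) * x"
    using Px' by (simp_all add: hprod_def hom_diff left_diff_distrib right_diff_distrib)
  ultimately show ?thesis
    using n Q unique unfolding s_def by blast
qed

end
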